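(* Let $n\ge 3$ be an integer and let ${}_nK=\varprojlim\{{}_nX_i,{}_n\Phi_i^j\}$ be the inverse limit generated by the sequence $\{{}_n\phi,{}_n\phi,\ldots\}$. Then every proper nondegenerate subcontinuum of ${}_nK$ is an arc.
   Context: Graphs. A continuum is a connected, compact, metric space. A graph is a one-dimensional, connected, finite simplicial complex with vertex set $\mathrm V(G)$ and edge set $\mathrm E(G)$; a map between graphs is simplicial if each edge is mapped linearly onto an edge or into a single vertex; $\langle x_0,x_1,\ldots,x_k\rangle$ denotes the path with consecutive adjacent vertices $x_0,\ldots,x_k$. A graph $G'$ subdivides $G$ if $\mathrm V(G)\subseteq \mathrm V(G')$ and each edge $e$ of $G$ is replaced by an arc $(e,G')\subseteq G'$ with the same end points as $e$, where $(d,G')\cap(e,G')=d\cap e$ for distinct edges $d,e$ of $G$, and $G'$ is the union of these arcs. If $\phi:G_1\to G_0$ is simplicial and collapses no edge, and $G_0'$ subdivides $G_0$, the subdivision of $\phi$ matching $G_0'$ is the (unique up to isomorphism) simplicial map $\phi':G_1'\to G_0'$ with $G_1'$ subdividing $G_1$, $\phi'=\phi$ on $\mathrm V(G_1)$, and $\phi'$ mapping $(e,G_1')$ isomorphically onto $(\phi(e),G_0')$ for each edge $e$ of $G_1$. The map ${}_n\phi$. Let ${}_nX_0$ be the graph with vertices $v_0,v_1,\ldots,v_{n+2}$ and edges $\langle v_0,v_i\rangle$ $(1\le i\le n)$, $\langle v_{n-1},v_{n+1}\rangle$, $\langle v_n,v_{n+2}\rangle$; it is a simple-$n$-od with arms ${}_nA_0^i=\langle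 v_0,v_i\rangle$ $(1\le i\le n-2)$, ${}_nA_0^{n-1}=\langle v_0,v_{n-1},v_{n+1}\rangle$, ${}_nA_0^n=\langle v_0,v_n,v_{n+2}\rangle$. For an integer $k$ let $[k]\in\{1,\ldots,n-2\}$ be its residue modulo $n-2$. The graph ${}_nX_1$ is a subdivision of ${}_nX_0$ with arms ${}_nA_1^i$ subdividing ${}_nA_0^i$, and ${}_n\phi:{}_nX_1\to {}_nX_0$ is the simplicial map, collapsing no edge, which sends the consecutive vertices of each arm, listed from $v_0$ outward, to the following consecutive vertices (one vertex of the arm for each entry): for $1\le i\le n-3$: ${}_nA_1^i\mapsto\langle v_0,v_{n-1},v_0,v_{[i]},v_0,v_{[i+1]},v_0,\ldots,v_{[i+n-3]},v_0,v_n,v_{n+2}\rangle$ (the last vertex of ${}_nA_1^i$ is $v_i$); ${}_nA_1^{n-2}\mapsto\langle v_0,v_{n-1},v_{n+1}\rangle$ (the last vertex is $v_{n-2}$); ${}_nA_1^{n-1}\mapsto\langle v_0,v_{n-1},v_0,v_n,v_{n+2}\rangle$ (the last two vertices are $v_{n-1},v_{n+1}$); ${}_nA_1^{n}\mapsto\langle v_0,v_{n-1},v_0,v_{n-2},v_0,v_1,v_0,v_2,v_0,\ldots,v_{n-3},v_0,v_n,v_{n+2}\rangle$ (the last two vertices are $v_n,v_{n+2}$; the part $v_1,v_0,\ldots,v_{n-3},v_0$ is empty if $n=3$). All other vertices of ${}_nX_1$ are new (not in $\mathrm V({}_nX_0)$). The inverse limit. Put $\psi_0={}_n\phi$, and for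 $i\ge 1$ let $\psi_i:{}_nX_{i+1}\to{}_nX_i$ be the subdivision of ${}_n\phi$ matching ${}_nX_i$ (${}_nX_i$ subdivides ${}_nX_0$). Let ${}_n\Phi_i^j=\psi_i\circ\psi_{i+1}\circ\cdots\circ\psi_{j-1}$ for $j>i$ and ${}_n\Phi_i^i=\mathrm{id}$. Then ${}_nK=\{(x_0,x_1,\ldots)\in\prod_{i\ge0}{}_nX_i:\psi_i(x_{i+1})=x_i\ \text{for all } i\}$. *)

theory Defs
  imports "HOL-Analysis.Analysis" "HOL-Library.Sublist"
begin

section \<open>Graphs, simplicial maps and subdivisions\<close>

text \<open>Graphs are finite abstract simplicial complexes of dimension one; an edge is the set of its
  two end points. The underlying space is the geometric realization defined further below.\<close>

record 'v graph =
  verts :: "'v set"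
  edges :: "'v set set"

definition adjacency :: "'v graph \<Rightarrow> 'v rel" where
  "adjacency G = {(u, v). {u, v} \<in> edges G}"

definition is_graph :: "'v graph \<Rightarrow> bool" where
  "is_graph G \<longleftrightarrow>
     finite (verts G) \<and> edges G \<noteq> {} \<and>
     (\<forall>e\<in>edges G. e \<subseteq> verts G \<and> card e = 2) \<and>
     (\<forall>u\<in>verts G. \<forall>v\<in>verts G. (u, v) \<in> (adjacency G)\<^sup>*)"

text \<open>A simplicial map is represented by its vertex map.\<close>

definition simplicial :: "'v graph \<Rightarrow> 'w graph \<Rightarrow> ('v \<Rightarrow> 'w) \<Rightarrow> bool" where
  "simplicial G H f \<longleftrightarrow>
     f ` verts G \<subseteq> verts H \<and>
     (\<forall>e\<in>edges G. f ` e \<in> edges H \<or> (\<exists>v\<in>verts H. f ` e = {v}))"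

definition collapses_no_edge :: "'v graph \<Rightarrow> ('v \<Rightarrow> 'w) \<Rightarrow> bool" where
  "collapses_no_edge G f \<longleftrightarrow> (\<forall>e\<in>edges G. \<nexists>v. f ` e = {v})"

definition graph_iso :: "'v graph \<Rightarrow> 'w graph \<Rightarrow> ('v \<Rightarrow> 'w) \<Rightarrow> bool" where
  "graph_iso G H f \<longleftrightarrow> bij_betw f (verts G) (verts H) \<and> (`) f ` edges G = edges H"

fun path_edges :: "'v list \<Rightarrow> 'v set set" where
  "path_edges (x # y # xs) = insert {x, y} (path_edges (y # xs))"
| "path_edges _ = {}"

definition path_graph :: "'v list \<Rightarrow> 'v graph" where
  "path_graph xs = \<lparr>verts = set xs, edges = path_edges xs\<rparr>"

definition is_arc :: "'v graph \<Rightarrow> 'v set \<Rightarrow> bool" where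
  "is_arc A e \<longleftrightarrow>
     (\<exists>xs. distinct xs \<and> 2 \<le> length xs \<and> A = path_graph xs \<and> e = {hd xs, last xs})"

text \<open>\<open>p e\<close> is the arc of \<open>G'\<close> that replaces the edge \<open>e\<close> of \<open>G\<close>. It is determined
  by \<open>G\<close> and \<open>G'\<close>, because its interior vertices are necessarily outside \<open>verts G\<close>.\<close>

definition subdivision_arcs :: "'v graph \<Rightarrow> 'v graph \<Rightarrow> ('v set \<Rightarrow> 'v graph) \<Rightarrow> bool" where
  "subdivision_arcs G G' p \<longleftrightarrow>
     is_graph G \<and> is_graph G' \<and> verts G \<subseteq> verts G' \<and>
     (\<forall>e\<in>edges G. is_arc (p e) e) \<and>
     (\<forall>d\<in>edges G. \<forall>e\<in>edges G. d \<noteq> e \<longrightarrow> verts (p d) \<inter> verts (p e) = d \<inter> e) \<and>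
     verts G' = (\<Union>e\<in>edges G. verts (p e)) \<and>
     edges G' = (\<Union>e\<in>edges G. edges (p e))"

definition matching_subdivision ::
  "'v graph \<Rightarrow> 'w graph \<Rightarrow> ('v \<Rightarrow> 'w) \<Rightarrow> 'w graph \<Rightarrow> 'v graph \<Rightarrow> ('v \<Rightarrow> 'w) \<Rightarrow> bool" where
  "matching_subdivision G1 G0 f G0' G1' f' \<longleftrightarrow>
     simplicial G1 G0 f \<and> collapses_no_edge G1 f \<and>
     simplicial G1' G0' f' \<and>
     (\<forall>v\<in>verts G1. f' v = f v) \<and>
     (\<exists>p0 p1. subdivision_arcs G0 G0' p0 \<and> subdivision_arcs G1 G1' p1 \<and>
        (\<forall>e\<in>edges G1. graph_iso (p1 e) (p0 (f ` e)) f'))"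

section \<open>Geometric realization and inverse limits\<close>

text \<open>Points are given by barycentric coordinates, extended by zero outside the vertex set; the
  topology is the one of pointwise convergence on \<open>'v \<Rightarrow> real\<close>.\<close>

definition realization :: "'v graph \<Rightarrow> ('v \<Rightarrow> real) set" where
  "realization G =
     {b. (\<forall>v. 0 \<le> b v) \<and> (\<Sum>v\<in>verts G. b v) = 1 \<and>
         ((\<exists>v\<in>verts G. {u. b u \<noteq> 0} = {v}) \<or> {u. b u \<noteq> 0} \<in> edges G)}"

definition realize_map :: "'v graph \<Rightarrow> ('v \<Rightarrow> 'w) \<Rightarrow> ('v \<Rightarrow> real) \<Rightarrow> ('w \<Rightarrow> real)" where
  "realize_map G f b = (\<lambda>w. \<Sum>v\<in>{v\<in>verts G. f v = w}. b v)"

definition inverse_limit :: "(nat \<Rightarrow> 'v graph) \<Rightarrow> (nat \<Rightarrow> 'v \<Rightarrow> 'v) \<Rightarrow> (nat \<Rightarrow> 'v \<Rightarrow> real) set" where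
  "inverse_limit X \<psi> =
     {x. (\<forall>i. x i \<in> realization (X i)) \<and>
         (\<forall>i. realize_map (X (Suc i)) (\<psi> i) (x (Suc i)) = x i)}"

definition continuum :: "'a::metric_space set \<Rightarrow> bool" where
  "continuum S \<longleftrightarrow> S \<noteq> {} \<and> compact S \<and> connected S"

definition nondegenerate :: "'a set \<Rightarrow> bool" where
  "nondegenerate S \<longleftrightarrow> (\<exists>x\<in>S. \<exists>y\<in>S. x \<noteq> y)"

section \<open>The map and the inverse sequence\<close>

text \<open>All graphs have natural numbers as vertices and \<open>v\<^sub>i\<close> is the number \<open>i\<close>; since the graphs are
  finite, \<open>nat\<close> always provides enough new vertices for subdivisions.\<close>

definition X0 :: "nat \<Rightarrow> nat graph" where
  "X0 n = \<lparr>verts = {0..n+2},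
           edges = {{0, i} | i. 1 \<le> i \<and> i \<le> n} \<union> {{n-1, n+1}, {n, n+2}}\<rparr>"

definition arm0 :: "nat \<Rightarrow> nat \<Rightarrow> nat list" where
  "arm0 n i = (if i = n - 1 then [0, n-1, n+1]
               else if i = n then [0, n, n+2]
               else [0, i])"

definition residue_index :: "nat \<Rightarrow> nat \<Rightarrow> nat" where
  "residue_index n k = (if k mod (n-2) = 0 then n-2 else k mod (n-2))"

definition phi_word :: "nat \<Rightarrow> nat \<Rightarrow> nat list" where
  "phi_word n i =
    (if i = n - 2 then [0, n-1, n+1]
     else if i = n - 1 then [0, n-1, 0, n, n+2]
     else if i = n then
       [0, n-1, 0, n-2] @ concat (map (\<lambda>j. [0, j]) [1..<n-2]) @ [0, n, n+2]
     else
       [0, n-1] @ concat (map (\<lambda>j. [0, residue_index n (i+j)]) [0..<n-2]) @ [0, n, n+2])"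

text \<open>\<open>A i\<close> lists the vertices of the \<open>i\<close>-th arm of \<open>X1\<close> from the branch point outward. It ends with the
  vertices of the \<open>i\<close>-th arm of \<open>X0 n\<close> other than the branch point.\<close>

definition is_phi :: "nat \<Rightarrow> nat graph \<Rightarrow> (nat \<Rightarrow> nat) \<Rightarrow> bool" where
  "is_phi n X1 \<phi> \<longleftrightarrow>
     simplicial X1 (X0 n) \<phi> \<and> collapses_no_edge X1 \<phi> \<and>
     (\<exists>p A. subdivision_arcs (X0 n) X1 p \<and>
        (\<forall>i\<in>{1..n}.
           distinct (A i) \<and> hd (A i) = 0 \<and> suffix (tl (arm0 n i)) (A i) \<and>
           set (A i) \<inter> verts (X0 n) = set (arm0 n i) \<and>
           subdivision_arcs (path_graph (arm0 n i)) (path_graph (A i)) p \<and>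
           map \<phi> (A i) = phi_word n i))"

text \<open>The matching subdivisions are unique only up to isomorphism; any choice of them is allowed.\<close>

definition phi_sequence :: "nat \<Rightarrow> (nat \<Rightarrow> nat graph) \<Rightarrow> (nat \<Rightarrow> nat \<Rightarrow> nat) \<Rightarrow> bool" where
  "phi_sequence n X \<psi> \<longleftrightarrow>
     X 0 = X0 n \<and> is_phi n (X 1) (\<psi> 0) \<and>
     (\<forall>i\<ge>1. matching_subdivision (X 1) (X 0) (\<psi> 0) (X i) (X (Suc i)) (\<psi> i))"

section \<open>Existence of the inverse sequence\<close>

text \<open>Matching subdivisions always exist for graphs over an infinite type (\<open>matching_exists\<close>), so
  \<open>phi_sequence n\<close> is satisfiable for all \<open>n \<ge> 3\<close> (\<open>phi_sequence_exists\<close>).\<close>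

lemma path_graph_simps [simp]:
  "verts (path_graph xs) = set xs" "edges (path_graph xs) = path_edges xs"
  by (simp_all add: path_graph_def)

lemma path_edges_subset: "e \<in> path_edges xs \<Longrightarrow> e \<subseteq> set xs"
  by (induction xs rule: path_edges.induct) auto

lemma path_edges_card: "distinct xs \<Longrightarrow> e \<in> path_edges xs \<Longrightarrow> card e = 2"
  by (induction xs rule: path_edges.induct) auto

lemma path_edges_Cons: "xs \<noteq> [] \<Longrightarrow> path_edges (x # xs) = insert {x, hd xs} (path_edges xs)"
  by (cases xs) auto

lemma path_edges_append:
  "xs \<noteq> [] \<Longrightarrow> ys \<noteq> [] \<Longrightarrow>
   path_edges (xs @ ys) = path_edges xs \<union> {{last xs, hd ys}} \<union> path_edges ys"
proof (induction xs)
  case (Cons x xs)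
  then show ?case by (cases "xs = []") (auto simp: path_edges_Cons)
qed simp

lemma path_edges_glue:
  assumes "2 \<le> length xs" "2 \<le> length ys" "last xs = hd ys"
  shows "path_edges (xs @ tl ys) = path_edges xs \<union> path_edges ys"
proof -
  obtain a b r where "ys = a # b # r"
    using assms(2) by (metis Suc_le_length_iff numeral_2_eq_2)
  moreover have "xs \<noteq> []" using assms(1) by auto
  ultimately show ?thesis using assms(3) by (auto simp: path_edges_append)
qed

lemma path_edges_rev: "path_edges (rev xs) = path_edges xs"
proof (induction xs)
  case (Cons x xs)
  then show ?case
    by (cases "xs = []") (auto simp: path_edges_append path_edges_Cons last_rev insert_commute)
qed simp

lemma path_edges_map: "path_edges (map f xs) = (`) f ` path_edges xs"
  by (induction xs rule: path_edges.induct) auto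

lemma path_edges_cover: "2 \<le> length xs \<Longrightarrow> \<Union> (path_edges xs) = set xs"
proof (induction xs rule: path_edges.induct)
  case (1 x y xs)
  then show ?case by (cases xs) auto
qed auto

lemma path_connected:
  assumes "path_edges xs \<subseteq> edges G" "u \<in> set xs" "v \<in> set xs"
  shows "(u, v) \<in> (adjacency G)\<^sup>*"
proof -
  have sy: "sym ((adjacency G)\<^sup>*)"
    by (rule sym_rtrancl) (auto simp: sym_def adjacency_def insert_commute)
  have *: "path_edges xs \<subseteq> edges G \<Longrightarrow> u \<in> set xs \<Longrightarrow> (hd xs, u) \<in> (adjacency G)\<^sup>*" for u
  proof (induction xs rule: path_edges.induct)
    case (1 x y xs)
    have "(x, y) \<in> adjacency G" using 1 by (auto simp: adjacency_def)
    then show ?case using 1 by (auto intro: converse_rtrancl_into_rtrancl)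
  qed auto
  show ?thesis using *[OF assms(1,2)] *[OF assms(1,3)] sy
    by (meson rtrancl_trans symD)
qed

lemma is_arc_props:
  assumes "is_arc A e"
  shows "finite (verts A)" "e \<subseteq> verts A" "card e = 2" "edges A \<noteq> {}"
    "\<And>d. d \<in> edges A \<Longrightarrow> d \<subseteq> verts A \<and> card d = 2" "\<Union> (edges A) = verts A"
proof -
  obtain xs where xs: "distinct xs" "2 \<le> length xs" "A = path_graph xs" "e = {hd xs, last xs}"
    using assms by (auto simp: is_arc_def)
  obtain a b r where ab: "xs = a # b # r"
    using xs(2) by (metis Suc_le_length_iff numeral_2_eq_2)
  show "finite (verts A)" "edges A \<noteq> {}" using xs ab by auto
  show "e \<subseteq> verts A" using xs ab by auto
  have "a \<noteq> last (b # r)" using xs(1) ab by (metis distinct.simps(2) last_in_set list.distinct(1))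
  then show "card e = 2" using xs ab by auto
  show "\<And>d. d \<in> edges A \<Longrightarrow> d \<subseteq> verts A \<and> card d = 2"
    using xs path_edges_subset path_edges_card by fastforce
  show "\<Union> (edges A) = verts A" using xs path_edges_cover by auto
qed

lemma is_arc_orient:
  assumes "is_arc A {x, y}" "x \<noteq> y"
  obtains zs where "distinct zs" "2 \<le> length zs" "A = path_graph zs" "hd zs = x" "last zs = y"
proof -
  obtain xs where xs: "distinct xs" "2 \<le> length xs" "A = path_graph xs" "{x,y} = {hd xs, last xs}"
    using assms by (auto simp: is_arc_def)
  show thesis
  proof (cases "hd xs = x")
    case True
    then show ?thesis using that[of xs] xs assms(2) by (metis doubleton_eq_iff)
  next
    case False
    then have "hd xs = y" "last xs = x" using xs(4) by (auto simp: doubleton_eq_iff)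
    moreover have "path_graph (rev xs) = path_graph xs"
      by (simp add: path_graph_def path_edges_rev)
    ultimately show ?thesis using that[of "rev xs"] xs
      by (metis distinct_rev hd_rev last_rev length_rev)
  qed
qed

lemma graph_vertex_edge:
  assumes "is_graph G" "v \<in> verts G"
  shows "\<exists>e\<in>edges G. v \<in> e"
proof -
  obtain e where e: "e \<in> edges G" using assms by (auto simp: is_graph_def)
  then have "e \<noteq> {}" "e \<subseteq> verts G" using assms by (auto simp: is_graph_def)
  then obtain a where a: "a \<in> e" "a \<in> verts G" by auto
  show ?thesis
  proof (cases "v = a")
    case False
    have "(v, a) \<in> (adjacency G)\<^sup>*" using assms a by (auto simp: is_graph_def)
    then obtain w where "(v, w) \<in> adjacency G" using False by (metis converse_rtranclE)
    then show ?thesis by (auto simp: adjacency_def)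
  qed (use e a in auto)
qed

lemma subdivision_arcsI:
  assumes G: "is_graph G"
    and arc: "\<And>e. e \<in> edges G \<Longrightarrow> is_arc (p e) e"
    and int: "\<And>d e. d \<in> edges G \<Longrightarrow> e \<in> edges G \<Longrightarrow> d \<noteq> e \<Longrightarrow> verts (p d) \<inter> verts (p e) = d \<inter> e"
    and V: "verts G' = (\<Union>e\<in>edges G. verts (p e))"
    and E: "edges G' = (\<Union>e\<in>edges G. edges (p e))"
  shows "subdivision_arcs G G' p"
proof -
  have sub: "verts G \<subseteq> verts G'"
    using graph_vertex_edge[OF G] is_arc_props(2)[OF arc] V by blast
  have finE: "finite (edges G)"
    by (rule finite_subset[of _ "Pow (verts G)"]) (use G in \<open>auto simp: is_graph_def\<close>)
  have conn1: "(u, v) \<in> (adjacency G')\<^sup>*" if e: "e \<in> edges G" "u \<in> verts (p e)" "v \<in> verts (p e)" for e u v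
  proof -
    obtain xs where "p e = path_graph xs" using arc[OF e(1)] by (auto simp: is_arc_def)
    moreover from this have "path_edges xs \<subseteq> edges G'" unfolding E using e(1) by force
    ultimately show ?thesis using path_connected[of xs G' u v] e by simp
  qed
  have conn2: "(u, v) \<in> (adjacency G')\<^sup>*" if "(u, v) \<in> (adjacency G)\<^sup>*" for u v
    using that
  proof induction
    case (step y z)
    then have "{y, z} \<in> edges G" by (auto simp: adjacency_def)
    then have "(y, z) \<in> (adjacency G')\<^sup>*" using conn1 is_arc_props(2)[OF arc] by blast
    then show ?case using step by auto
  qed auto
  have near: "\<exists>w\<in>verts G. (u, w) \<in> (adjacency G')\<^sup>* \<and> (w, u) \<in> (adjacency G')\<^sup>*" if u: "u \<in> verts G'" for u
  proof -
    obtain e where e: "e \<in> edges G" "u \<in> verts (p e)" using u V by auto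
    have "e \<noteq> {}" "e \<subseteq> verts G" using G e by (auto simp: is_graph_def)
    then obtain w where w: "w \<in> e" "w \<in> verts G" by auto
    then have "w \<in> verts (p e)" using is_arc_props(2)[OF arc] e by blast
    then show ?thesis using conn1 e w by blast
  qed
  have "is_graph G'"
    unfolding is_graph_def
  proof (intro conjI ballI)
    show "finite (verts G')" using V finE is_arc_props(1)[OF arc] by auto
    show "edges G' \<noteq> {}" using E G is_arc_props(4)[OF arc] by (auto simp: is_graph_def)
    fix d assume "d \<in> edges G'"
    then obtain e where "e \<in> edges G" "d \<in> edges (p e)" using E by auto
    then show "d \<subseteq> verts G'" "card d = 2" using is_arc_props(5)[OF arc] V by blast+
  next
    fix u v assume uv: "u \<in> verts G'" "v \<in> verts G'"
    obtain w where w: "w \<in> verts G" "(u, w) \<in> (adjacency G')\<^sup>*" using near uv by blast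
    obtain z where z: "z \<in> verts G" "(z, v) \<in> (adjacency G')\<^sup>*" using near uv by blast
    have "(w, z) \<in> (adjacency G')\<^sup>*" using conn2 G w z by (auto simp: is_graph_def)
    then show "(u, v) \<in> (adjacency G')\<^sup>*" using w z by (meson rtrancl_trans)
  qed
  then show ?thesis using assms sub by (auto simp: subdivision_arcs_def)
qed

lemma subdivision_arcsD:
  assumes "subdivision_arcs G G' p"
  shows "is_graph G" "is_graph G'" "verts G \<subseteq> verts G'"
    "\<And>e. e \<in> edges G \<Longrightarrow> is_arc (p e) e"
    "\<And>d e. d \<in> edges G \<Longrightarrow> e \<in> edges G \<Longrightarrow> d \<noteq> e \<Longrightarrow> verts (p d) \<inter> verts (p e) = d \<inter> e"
    "verts G' = (\<Union>e\<in>edges G. verts (p e))"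
    "edges G' = (\<Union>e\<in>edges G. edges (p e))"
proof -
  have *: "\<forall>d\<in>edges G. \<forall>e\<in>edges G. d \<noteq> e \<longrightarrow> verts (p d) \<inter> verts (p e) = d \<inter> e"
    using assms unfolding subdivision_arcs_def by (elim conjE)
  show "\<And>d e. d \<in> edges G \<Longrightarrow> e \<in> edges G \<Longrightarrow> d \<noteq> e \<Longrightarrow> verts (p d) \<inter> verts (p e) = d \<inter> e"
    by (rule *[rule_format])
  show "verts G \<subseteq> verts G'" using assms unfolding subdivision_arcs_def by (elim conjE)
qed (use assms in \<open>simp_all add: subdivision_arcs_def\<close>)

lemma subdivide_path:
  assumes "\<And>e. e \<in> path_edges xs \<Longrightarrow> is_arc (q e) e"
    and "\<And>d e. d \<in> path_edges xs \<Longrightarrow> e \<in> path_edges xs \<Longrightarrow> d \<noteq> e \<Longrightarrow> verts (q d) \<inter> verts (q e) = d \<inter> e"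
    and "distinct xs" "2 \<le> length xs"
  shows "\<exists>ys. distinct ys \<and> 2 \<le> length ys \<and> hd ys = hd xs \<and> last ys = last xs \<and>
    set ys = (\<Union>e\<in>path_edges xs. verts (q e)) \<and> path_edges ys = (\<Union>e\<in>path_edges xs. edges (q e))"
  using assms
proof (induction xs rule: path_edges.induct)
  case (1 x y xs)
  have "is_arc (q {x, y}) {x, y}" "x \<noteq> y" using 1 by auto
  then obtain zs where zs: "distinct zs" "2 \<le> length zs" "q {x, y} = path_graph zs" "hd zs = x" "last zs = y"
    by (rule is_arc_orient)
  show ?case
  proof (cases xs)
    case Nil
    then show ?thesis using zs by (intro exI[of _ zs]) auto
  next
    case (Cons z r)
    have "\<exists>ys. distinct ys \<and> 2 \<le> length ys \<and> hd ys = hd (y # xs) \<and> last ys = last (y # xs) \<and>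
      set ys = (\<Union>e\<in>path_edges (y # xs). verts (q e)) \<and> path_edges ys = (\<Union>e\<in>path_edges (y # xs). edges (q e))"
      by (rule "1.IH") (use 1 Cons in auto)
    then obtain ys where ys: "distinct ys" "2 \<le> length ys" "hd ys = y" "last ys = last (y # xs)"
      "set ys = (\<Union>e\<in>path_edges (y # xs). verts (q e))" "path_edges ys = (\<Union>e\<in>path_edges (y # xs). edges (q e))"
      by auto
    have *: "set zs \<inter> set ys \<subseteq> {y}"
    proof
      fix w assume w: "w \<in> set zs \<inter> set ys"
      then obtain d where d: "d \<in> path_edges (y # xs)" "w \<in> verts (q d)" using ys by auto
      have "x \<notin> d" using d path_edges_subset[of d "y # xs"] 1(4) by auto
      then have "verts (q {x,y}) \<inter> verts (q d) = {x,y} \<inter> d"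
        by (intro 1(3)) (use d in auto)
      then show "w \<in> {y}" using \<open>x \<notin> d\<close> d w zs by auto
    qed
    obtain a b t where t: "ys = a # b # t"
      using ys(2) by (metis Suc_le_length_iff numeral_2_eq_2)
    have zs_ne: "zs \<noteq> []" using zs(2) by auto
    have y: "y \<in> set zs" using zs(5) zs_ne by auto
    have pe: "path_edges (zs @ tl ys) = path_edges zs \<union> path_edges ys"
      by (rule path_edges_glue) (use zs ys in auto)
    show ?thesis
    proof (intro exI[of _ "zs @ tl ys"] conjI)
      show "distinct (zs @ tl ys)" using zs(1) ys(1,3) t * by auto
      show "2 \<le> length (zs @ tl ys)" using zs by auto
      show "hd (zs @ tl ys) = hd (x # y # xs)" using zs zs_ne by auto
      show "last (zs @ tl ys) = last (x # y # xs)" using ys t by auto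
      have "set (zs @ tl ys) = set zs \<union> set ys" using t ys(3) y by auto
      then show "set (zs @ tl ys) = (\<Union>e\<in>path_edges (x # y # xs). verts (q e))" using zs ys by auto
      show "path_edges (zs @ tl ys) = (\<Union>e\<in>path_edges (x # y # xs). edges (q e))"
        using pe zs ys by auto
    qed
  qed
qed auto

lemma card_2_Int: "card d = 2 \<Longrightarrow> card e = 2 \<Longrightarrow> d \<noteq> e \<Longrightarrow> c \<subseteq> d \<inter> e \<Longrightarrow> card c \<noteq> 2"
  by (metis Int_lower1 Int_lower2 card_subset_eq card.infinite dual_order.trans zero_neq_numeral)

lemma subdivision_trans:
  assumes p: "subdivision_arcs G G' p" and q: "subdivision_arcs G' G'' q"
  shows "\<exists>r. subdivision_arcs G G'' r"
proof -
  define r where "r e = \<lparr>verts = (\<Union>d\<in>edges (p e). verts (q d)), edges = (\<Union>d\<in>edges (p e). edges (q d))\<rparr>" for e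
  note G = subdivision_arcsD(1)[OF p] and parc = subdivision_arcsD(4)[OF p]
    and pint = subdivision_arcsD(5)[OF p] and pE = subdivision_arcsD(7)[OF p]
  note qarc = subdivision_arcsD(4)[OF q] and qint = subdivision_arcsD(5)[OF q]
    and qV = subdivision_arcsD(6)[OF q] and qE = subdivision_arcsD(7)[OF q]
  have "subdivision_arcs G G'' r"
  proof (rule subdivision_arcsI[OF G])
    fix e assume e: "e \<in> edges G"
    obtain xs where xs: "distinct xs" "2 \<le> length xs" "p e = path_graph xs" "e = {hd xs, last xs}"
      using parc[OF e] by (auto simp: is_arc_def)
    have "path_edges xs \<subseteq> edges G'" using xs(3) pE e by auto
    then have "\<exists>ys. distinct ys \<and> 2 \<le> length ys \<and> hd ys = hd xs \<and> last ys = last xs \<and>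
      set ys = (\<Union>e\<in>path_edges xs. verts (q e)) \<and> path_edges ys = (\<Union>e\<in>path_edges xs. edges (q e))"
      by (intro subdivide_path xs) (use qarc qint in blast)+
    then obtain ys where "distinct ys" "2 \<le> length ys" "hd ys = hd xs" "last ys = last xs"
      "set ys = (\<Union>e\<in>path_edges xs. verts (q e))" "path_edges ys = (\<Union>e\<in>path_edges xs. edges (q e))"
      by blast
    then show "is_arc (r e) e"
      unfolding is_arc_def r_def path_graph_def using xs by (intro exI[of _ ys]) auto
  next
    fix d e assume de: "d \<in> edges G" "e \<in> edges G" "d \<noteq> e"
    show "verts (r d) \<inter> verts (r e) = d \<inter> e"
    proof
      show "verts (r d) \<inter> verts (r e) \<subseteq> d \<inter> e"
      proof
        fix w assume "w \<in> verts (r d) \<inter> verts (r e)"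
        then obtain d' e' where w: "d' \<in> edges (p d)" "w \<in> verts (q d')" "e' \<in> edges (p e)" "w \<in> verts (q e')"
          by (auto simp: r_def)
        note dp = is_arc_props(5)[OF parc[OF de(1)] w(1)]
        note ep = is_arc_props(5)[OF parc[OF de(2)] w(3)]
        have sub: "d' \<inter> e' \<subseteq> d \<inter> e" using dp ep pint[OF de] by blast
        have "d' \<noteq> e'"
          using card_2_Int[OF is_arc_props(3)[OF parc[OF de(1)]] is_arc_props(3)[OF parc[OF de(2)]] de(3), of d'] sub dp
          by auto
        then have "verts (q d') \<inter> verts (q e') = d' \<inter> e'"
          by (intro qint) (use pE de w in auto)
        then show "w \<in> d \<inter> e" using w sub by auto
      qed
      have "e \<subseteq> verts (r e)" if "e \<in> edges G" for e
      proof
        fix w assume "w \<in> e"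
        then have "w \<in> \<Union> (edges (p e))"
          using is_arc_props(2,6)[OF parc[OF that]] by auto
        then obtain d where d: "d \<in> edges (p e)" "w \<in> d" by auto
        then have "d \<in> edges G'" using pE that by auto
        then have "w \<in> verts (q d)" using is_arc_props(2)[OF qarc] d by auto
        then show "w \<in> verts (r e)" using d by (auto simp: r_def)
      qed
      then show "d \<inter> e \<subseteq> verts (r d) \<inter> verts (r e)" using de by blast
    qed
  next
    show "verts G'' = (\<Union>e\<in>edges G. verts (r e))" using qV pE by (auto simp: r_def)
    show "edges G'' = (\<Union>e\<in>edges G. edges (r e))" using qE pE by (auto simp: r_def)
  qed
  then show ?thesis by (intro exI[of _ r])
qed

lemma matching_exists:
  fixes f :: "'v \<Rightarrow> 'w"
  assumes inf: "infinite (UNIV :: 'v set)"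
    and f: "simplicial G1 G0 f" "collapses_no_edge G1 f"
    and G1: "is_graph G1" and p0: "subdivision_arcs G0 G0' p0"
  shows "\<exists>G1' f' p1. matching_subdivision G1 G0 f G0' G1' f' \<and> subdivision_arcs G1 G1' p1"
proof -
  note G0 = subdivision_arcsD(1,2)[OF p0] and parc = subdivision_arcsD(4)[OF p0]
    and pV = subdivision_arcsD(6)[OF p0] and pE = subdivision_arcsD(7)[OF p0]
  have fe: "f ` e \<in> edges G0" if "e \<in> edges G1" for e
    using f that by (auto simp: simplicial_def collapses_no_edge_def)
  have ec: "card e = 2 \<and> e \<subseteq> verts G1" if "e \<in> edges G1" for e
    using G1 that by (auto simp: is_graph_def)
  have inje: "inj_on f e" if "e \<in> edges G1" for e
  proof -
    have "card (f ` e) = 2" using fe[OF that] G0 by (auto simp: is_graph_def)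
    then show ?thesis using ec[OF that] by (metis eq_card_imp_inj_on card.infinite zero_neq_numeral)
  qed
  have fin: "finite (verts G1)" "finite (verts G0')" using G1 G0 by (auto simp: is_graph_def)
  have finE: "finite (edges G1)"
    by (rule finite_subset[of _ "Pow (verts G1)"]) (use G1 in \<open>auto simp: is_graph_def\<close>)
  let ?N = "edges G1 \<times> verts G0'"
  have finN: "finite ?N" using fin finE by auto
  have "infinite (UNIV - verts G1)" using inf fin by auto
  then obtain B where B: "finite B" "card B = card ?N" "B \<subseteq> UNIV - verts G1"
    using infinite_arbitrarily_large by blast
  obtain h where h: "bij_betw h ?N B"
    using finite_same_card_bij[OF finN B(1)] B(2) by auto
  have hinj: "inj_on h ?N" and hnew: "\<And>z. z \<in> ?N \<Longrightarrow> h z \<notin> verts G1"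
    using h B(3) by (auto simp: bij_betw_def)
  define g where "g e x = (if x \<in> f ` e then inv_into e f x else h (e, x))" for e x
  define f' where "f' u = (if u \<in> verts G1 then f u else snd (inv_into ?N h u))" for u
  have psub: "verts (p0 (f ` e)) \<subseteq> verts G0'" "f ` e \<subseteq> verts (p0 (f ` e))" if "e \<in> edges G1" for e
    using pV fe[OF that] is_arc_props(2)[OF parc] by blast+
  have gold: "g e (f u) = u" if "e \<in> edges G1" "u \<in> e" for e u
    using that inje by (auto simp: g_def)
  have gin: "g e x \<in> e \<longleftrightarrow> x \<in> f ` e" if "e \<in> edges G1" "x \<in> verts (p0 (f ` e))" for e x
    using that hnew[of "(e, x)"] psub[OF that(1)] ec[OF that(1)] by (auto simp: g_def inv_into_into)
  have gin': "g e x \<in> verts G1 \<longleftrightarrow> x \<in> f ` e" if "e \<in> edges G1" "x \<in> verts (p0 (f ` e))" for e x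
    using that hnew[of "(e, x)"] psub[OF that(1)] ec[OF that(1)] by (auto simp: g_def inv_into_into)
  have f'g: "f' (g e x) = x" if e: "e \<in> edges G1" "x \<in> verts (p0 (f ` e))" for e x
  proof (cases "x \<in> f ` e")
    case True
    then show ?thesis using gin'[OF e] by (simp add: f'_def g_def f_inv_into_f)
  next
    case False
    have "(e, x) \<in> ?N" using e psub by auto
    then show ?thesis using False gin'[OF e] hinj by (simp add: f'_def) (simp add: g_def)
  qed
  have ginj: "inj_on (g e) (verts (p0 (f ` e)))" if "e \<in> edges G1" for e
    by (rule inj_on_inverseI[of _ f']) (use f'g that in auto)
  define p1 where "p1 e = \<lparr>verts = g e ` verts (p0 (f ` e)), edges = (`) (g e) ` edges (p0 (f ` e))\<rparr>" for e
  define G1' where "G1' = \<lparr>verts = (\<Union>e\<in>edges G1. verts (p1 e)), edges = (\<Union>e\<in>edges G1. edges (p1 e))\<rparr>"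
  have sub1: "subdivision_arcs G1 G1' p1"
  proof (rule subdivision_arcsI[OF G1])
    fix e assume e: "e \<in> edges G1"
    obtain xs where xs: "distinct xs" "2 \<le> length xs" "p0 (f ` e) = path_graph xs" "f ` e = {hd xs, last xs}"
      using parc[OF fe[OF e]] by (auto simp: is_arc_def)
    have ne: "xs \<noteq> []" using xs by auto
    have "e = g e ` f ` e" using gold[OF e] by force
    then have "e = {hd (map (g e) xs), last (map (g e) xs)}" using xs ne by (simp add: hd_map last_map)
    moreover have "distinct (map (g e) xs)" using xs ginj[OF e] by (simp add: distinct_map)
    moreover have "p1 e = path_graph (map (g e) xs)"
      using xs by (simp add: p1_def path_graph_def path_edges_map)
    ultimately show "is_arc (p1 e) e"
      unfolding is_arc_def using xs(2) by (intro exI[of _ "map (g e) xs"]) auto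
  next
    fix d e assume de: "d \<in> edges G1" "e \<in> edges G1" "d \<noteq> e"
    show "verts (p1 d) \<inter> verts (p1 e) = d \<inter> e"
    proof
      show "verts (p1 d) \<inter> verts (p1 e) \<subseteq> d \<inter> e"
      proof
        fix w assume "w \<in> verts (p1 d) \<inter> verts (p1 e)"
        then obtain x y where xy: "x \<in> verts (p0 (f ` d))" "y \<in> verts (p0 (f ` e))" "w = g d x" "w = g e y"
          by (auto simp: p1_def)
        have "x \<in> f ` d"
        proof (rule ccontr)
          assume n: "x \<notin> f ` d"
          then have "w \<notin> verts G1" using gin'[OF de(1) xy(1)] xy(3) by simp
          then have n2: "y \<notin> f ` e" using gin'[OF de(2) xy(2)] xy(4) by simp
          then have "h (d, x) = h (e, y)" using n xy by (simp add: g_def)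
          moreover have "(d, x) \<in> ?N" "(e, y) \<in> ?N" using psub de xy by auto
          ultimately have "(d, x) = (e, y)" using hinj by (meson inj_onD)
          then show False using de by simp
        qed
        moreover from this have "w \<in> verts G1" using gin'[OF de(1) xy(1)] xy(3) by simp
        then have "y \<in> f ` e" using gin'[OF de(2) xy(2)] xy(4) by simp
        ultimately show "w \<in> d \<inter> e"
          using gin[OF de(1) xy(1)] gin[OF de(2) xy(2)] xy(3,4) by simp
      qed
      have "u \<in> verts (p1 e)" if "e \<in> edges G1" "u \<in> e" for u e
        using gold[OF that] psub(2)[OF that(1)] that unfolding p1_def by (force intro: image_eqI[of _ _ "f u"])
      then show "d \<inter> e \<subseteq> verts (p1 d) \<inter> verts (p1 e)" using de by blast
    qed
  qed (simp_all add: G1'_def)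
  have img: "f' ` g e ` c = c" if "e \<in> edges G1" "c \<subseteq> verts (p0 (f ` e))" for c e
    using f'g[OF that(1)] that(2) by (force simp: image_image)
  have iso: "graph_iso (p1 e) (p0 (f ` e)) f'" if e: "e \<in> edges G1" for e
    unfolding graph_iso_def
  proof
    show "bij_betw f' (verts (p1 e)) (verts (p0 (f ` e)))"
      using f'g[OF e] by (auto simp: p1_def bij_betw_def inj_on_def image_image)
    have "f' ` g e ` c = c" if "c \<in> edges (p0 (f ` e))" for c
      using img[OF e] is_arc_props(5)[OF parc[OF fe[OF e]] that] by auto
    then show "(`) f' ` edges (p1 e) = edges (p0 (f ` e))"
      by (auto simp: p1_def image_image)
  qed
  have "simplicial G1' G0' f'"
    unfolding simplicial_def
  proof (intro conjI ballI disjI1)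
    show "f' ` verts G1' \<subseteq> verts G0'"
      using f'g by (auto simp: G1'_def p1_def dest: subsetD[OF psub(1)])
    fix c assume "c \<in> edges G1'"
    then obtain e where e: "e \<in> edges G1" "c \<in> edges (p1 e)" by (auto simp: G1'_def)
    then have "f' ` c \<in> edges (p0 (f ` e))" using iso[OF e(1)] by (auto simp: graph_iso_def)
    then show "f' ` c \<in> edges G0'" using pE fe[OF e(1)] by auto
  qed
  moreover have "\<forall>v\<in>verts G1. f' v = f v" by (simp add: f'_def)
  ultimately have "matching_subdivision G1 G0 f G0' G1' f'"
    unfolding matching_subdivision_def using f p0 sub1 iso by blast
  then show ?thesis using sub1 by blast
qed


lemma is_graph_path:
  assumes "distinct xs" "2 \<le> length xs"
  shows "is_graph (path_graph xs)"
proof -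
  have "path_edges xs \<noteq> {}" using path_edges_cover[OF assms(2)] assms(2) by auto
  then show ?thesis
    using path_connected[of xs "path_graph xs"] path_edges_subset path_edges_card[OF assms(1)]
    by (auto simp: is_graph_def) blast
qed

lemma is_graph_X0:
  assumes "3 \<le> n"
  shows "is_graph (X0 n)"
proof -
  have sy: "sym ((adjacency (X0 n))\<^sup>*)"
    by (rule sym_rtrancl) (auto simp: sym_def adjacency_def insert_commute)
  have a: "(0, i) \<in> (adjacency (X0 n))\<^sup>*" if "1 \<le> i" "i \<le> n" for i
    using that by (intro r_into_rtrancl) (auto simp: adjacency_def X0_def)
  have b: "(n-1, n+1) \<in> adjacency (X0 n)" "(n, n+2) \<in> adjacency (X0 n)"
    by (auto simp: adjacency_def X0_def)
  have c: "(0, v) \<in> (adjacency (X0 n))\<^sup>*" if v: "v \<in> verts (X0 n)" for v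
  proof -
    consider "v = 0" | "1 \<le> v" "v \<le> n" | "v = n + 1" | "v = n + 2"
      using v unfolding X0_def by (simp, linarith)
    then show ?thesis
    proof cases
      case 3
      have "(0, n-1) \<in> (adjacency (X0 n))\<^sup>*" using a[of "n-1"] assms by simp
      then show ?thesis using 3 b(1) by (metis rtrancl.rtrancl_into_rtrancl)
    next
      case 4
      have "(0, n) \<in> (adjacency (X0 n))\<^sup>*" using a[of n] assms by simp
      then show ?thesis using 4 b(2) by (metis rtrancl.rtrancl_into_rtrancl)
    qed (use a in auto)
  qed
  have d: "(u, v) \<in> (adjacency (X0 n))\<^sup>*" if "u \<in> verts (X0 n)" "v \<in> verts (X0 n)" for u v
    using c[OF that(1)] c[OF that(2)] sy by (meson rtrancl_trans symD)
  have "e \<subseteq> verts (X0 n) \<and> card e = 2" if "e \<in> edges (X0 n)" for e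
    using that by (auto simp: X0_def)
  then show ?thesis using d by (auto simp: is_graph_def) (auto simp: X0_def)
qed

lemma path_edges_word:
  "path_edges (x # concat (map (\<lambda>j. [0, g j]) js) @ [0, b, c]) \<subseteq>
     {{x, 0}} \<union> (\<lambda>j. {0, g j}) ` set js \<union> {{0, b}, {b, c}}"
proof (induction js arbitrary: x)
  case (Cons a js)
  have *: "{g a, 0} = {0, g a}" by auto
  have "path_edges (x # concat (map (\<lambda>j. [0, g j]) (a # js)) @ [0, b, c]) =
    insert {x, 0} (insert {0, g a} (path_edges (g a # concat (map (\<lambda>j. [0, g j]) js) @ [0, b, c])))"
    by simp
  also have "\<dots> \<subseteq> insert {x, 0} (insert {0, g a} ({{g a, 0}} \<union> (\<lambda>j. {0, g j}) ` set js \<union> {{0, b}, {b, c}}))"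
    using Cons[of "g a"] by (intro insert_mono)
  also have "\<dots> = {{x, 0}} \<union> (\<lambda>j. {0, g j}) ` set (a # js) \<union> {{0, b}, {b, c}}"
    unfolding * by (simp add: insert_commute)
  finally show ?case .
qed simp

lemma residue_index_bounds:
  assumes "3 \<le> n"
  shows "1 \<le> residue_index n k" "residue_index n k \<le> n - 2"
proof -
  have "k mod (n-2) < n - 2" using assms by simp
  then show "1 \<le> residue_index n k" "residue_index n k \<le> n - 2"
    unfolding residue_index_def by simp_all
qed

lemma phi_word_edges:
  assumes n: "3 \<le> n" and i: "i \<in> {1..n}"
  shows "path_edges (phi_word n i) \<subseteq> edges (X0 n)"
proof -
  have E: "{0, k} \<in> edges (X0 n)" "{k, 0} \<in> edges (X0 n)" if "1 \<le> k" "k \<le> n" for k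
    using that by (auto simp: X0_def insert_commute)
  have E2: "{n-1, n+1} \<in> edges (X0 n)" "{n, n+2} \<in> edges (X0 n)" by (auto simp: X0_def)
  note EE = E[of n] E[of "n-1"] E[of "n-2"] E2
  consider "i = n - 2" | "i = n - 1" | "i = n" | "i \<noteq> n-2" "i \<noteq> n-1" "i \<noteq> n" by blast
  then show ?thesis
  proof cases
    case 1
    then show ?thesis using EE n by (simp add: phi_word_def)
  next
    case 2
    then have "phi_word n i = [0, n-1, 0, n, n+2]" using n by (auto simp: phi_word_def)
    then show ?thesis using EE n by simp
  next
    case 3
    then have "phi_word n i = 0 # (n-1) # 0 # (n-2) # concat (map (\<lambda>j. [0, j]) [1..<n-2]) @ [0, n, n+2]"
      using n by (auto simp: phi_word_def)
    moreover have "path_edges ((n-2) # concat (map (\<lambda>j. [0, j]) [1..<n-2]) @ [0, n, n+2]) \<subseteq> edges (X0 n)"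
    proof (rule order_trans[OF path_edges_word])
      have "{0, j} \<in> edges (X0 n)" if "j \<in> set [1..<n-2]" for j
        by (rule E) (use that in auto)
      then show "{{n - 2, 0}} \<union> (\<lambda>j. {0, j}) ` set [1..<n - 2] \<union> {{0, n}, {n, n + 2}}
        \<subseteq> edges (X0 n)" using EE n by auto
    qed
    ultimately show ?thesis using EE n by simp
  next
    case 4
    then have "phi_word n i = 0 # (n-1) # concat (map (\<lambda>j. [0, residue_index n (i+j)]) [0..<n-2]) @ [0, n, n+2]"
      by (auto simp: phi_word_def)
    moreover have "path_edges ((n-1) # concat (map (\<lambda>j. [0, residue_index n (i+j)]) [0..<n-2]) @ [0, n, n+2]) \<subseteq> edges (X0 n)"
    proof (rule order_trans[OF path_edges_word])
      have "{0, residue_index n (i+j)} \<in> edges (X0 n)" for j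
        by (rule E) (use residue_index_bounds[OF n, of "i+j"] in linarith)+
      then show "{{n - 1, 0}} \<union> (\<lambda>j. {0, residue_index n (i + j)}) ` set [0..<n - 2] \<union> {{0, n}, {n, n + 2}}
        \<subseteq> edges (X0 n)" using EE n by auto
    qed
    ultimately show ?thesis using EE n by simp
  qed
qed

lemma phi_exists:
  assumes n: "3 \<le> n"
  shows "\<exists>X1 \<phi>. is_phi n X1 \<phi>"
proof -
  define w where "w i j = n + 3 + prod_encode (i, j)" for i j
  define m where "m i = length (phi_word n i) + 1 - length (arm0 n i)" for i
  define W where "W i = w i ` {1..<m i}" for i
  define B where "B i = 0 # map (w i) [1..<m i] @ [i]" for i
  define T where "T i = (if i = n-1 then [n+1] else if i = n then [n+2] else [])" for i
  define A where "A i = B i @ T i" for i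
  define p where "p e = (if 0 \<in> e then path_graph (B (Max e)) else \<lparr>verts = e, edges = {e}\<rparr>)" for e
  define X1 where "X1 = \<lparr>verts = (\<Union>e\<in>edges (X0 n). verts (p e)), edges = (\<Union>e\<in>edges (X0 n). edges (p e))\<rparr>"
  have wV: "w i j > n + 2" for i j by (simp add: w_def)
  have winj: "w i j = w i' j' \<longleftrightarrow> i = i' \<and> j = j'" for i j i' j' by (simp add: w_def)
  have setB: "set (B i) = {0, i} \<union> W i" for i by (auto simp: B_def W_def)
  have W: "W i \<inter> {0..n+2} = {}" for i
  proof -
    have "x \<notin> {0..n+2}" if x: "x \<in> W i" for x
    proof -
      obtain j where "x = w i j" using x by (auto simp: W_def)
      then show ?thesis using wV[of i j] by simp
    qed
    then show ?thesis by blast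
  qed
  have WW: "W i \<inter> W j = {}" if "i \<noteq> j" for i j using winj that by (auto simp: W_def)
  have dB: "distinct (B i)" if "i \<in> {1..n}" for i
  proof -
    have "i \<noteq> w i j" "0 \<noteq> w i j" for j using wV[of i j] that by auto
    then have "i \<notin> w i ` S" "0 \<notin> w i ` S" for S by blast+
    then show ?thesis using that by (simp add: B_def distinct_map inj_on_def winj)
  qed
  have lword: "3 \<le> length (phi_word n i)" for i by (simp add: phi_word_def)
  have arm: "arm0 n i = 0 # i # T i" if "i \<in> {1..n}" for i
    using that n by (auto simp: arm0_def T_def)
  have T: "set (T i) \<subseteq> {n+1, n+2}" "length (T i) \<le> 1" "distinct (T i)" for i by (auto simp: T_def)
  have TT: "set (T i) \<inter> set (T j) = {}" if "i \<noteq> j" for i j using that n by (auto simp: T_def)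
  have WT: "W i \<inter> set (T j) = {}" for i j
  proof -
    have "set (T j) \<subseteq> {0..n+2}" using T(1)[of j] by auto
    then show ?thesis using W[of i] by blast
  qed
  have Wi: "j \<notin> W i" if "j \<le> n + 2" for i j using W[of i] that by auto
  have lA: "length (A i) = length (phi_word n i)" if "i \<in> {1..n}" for i
    using lword[of i] T(2)[of i] by (simp add: A_def B_def m_def arm[OF that])
  have setA: "set (A i) = {0, i} \<union> W i \<union> set (T i)" for i by (simp add: A_def setB)
  have dA: "distinct (A i)" if "i \<in> {1..n}" for i
    using dB[OF that] T[of i] WT[of i i] that by (auto simp: A_def setB)
  have A0: "A i ! 0 = 0" "hd (A i) = 0" for i by (simp_all add: A_def B_def)
  have Ashare: "i = i'" if "i \<in> {1..n}" "i' \<in> {1..n}" "v \<in> set (A i)" "v \<in> set (A i')" "v \<noteq> 0" for i i' v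
  proof (rule ccontr)
    assume ne: "i \<noteq> i'"
    show False
      using that Wi[of i i'] Wi[of i' i] WW[OF ne] TT[OF ne] WT[of i i'] WT[of i' i] T(1)[of i] T(1)[of i'] ne
      unfolding setA by auto
  qed
  define \<phi> where "\<phi> v = (case (SOME (i, j). i \<in> {1..n} \<and> j < length (A i) \<and> A i ! j = v) of (i, j) \<Rightarrow> phi_word n i ! j)" for v
  have word0: "phi_word n i ! 0 = 0" for i by (simp add: phi_word_def)
  have phi: "\<phi> (A i ! j) = phi_word n i ! j" if "i \<in> {1..n}" "j < length (A i)" for i j
  proof -
    define P where "P = (\<lambda>(i', j'). i' \<in> {1..n} \<and> j' < length (A i') \<and> A i' ! j' = A i ! j)"
    obtain i' j' where ij: "(SOME z. P z) = (i', j')" by (cases "SOME z. P z")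
    have "P (i, j)" using that by (simp add: P_def)
    then have "P (SOME z. P z)" by (rule someI)
    then have 1: "i' \<in> {1..n}" "j' < length (A i')" "A i' ! j' = A i ! j" unfolding ij by (auto simp: P_def)
    have 2: "\<phi> (A i ! j) = phi_word n i' ! j'" unfolding \<phi>_def P_def[symmetric] ij by simp
    show ?thesis
    proof (cases "A i ! j = 0")
      case True
      have "j = 0" "j' = 0"
        using dA[OF that(1)] dA[OF 1(1)] A0 True 1 that nth_eq_iff_index_eq[of "A i" j 0]
          nth_eq_iff_index_eq[of "A i'" j' 0] by (auto simp: A_def B_def)
      then show ?thesis using 2 word0 by simp
    next
      case False
      have "i' = i" by (rule Ashare[OF 1(1) that(1), of "A i ! j"]) (use 1 that False nth_mem in \<open>metis\<close>)+
      then show ?thesis using 1 2 dA[OF that(1)] that nth_eq_iff_index_eq by metis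
    qed
  qed
  have mapA: "map \<phi> (A i) = phi_word n i" if "i \<in> {1..n}" for i
    by (rule nth_equalityI) (use phi lA that in auto)
  have pe0: "p {0, i} = path_graph (B i)" if "i \<in> {1..n}" for i
    by (simp add: p_def)
  have pe1: "p {n-1, n+1} = path_graph [n-1, n+1]" "p {n, n+2} = path_graph [n, n+2]"
    using n by (auto simp: p_def path_graph_def)
  have E0: "edges (X0 n) = (\<lambda>i. {0, i}) ` {1..n} \<union> {{n-1, n+1}, {n, n+2}}"
    by (auto simp: X0_def)
  have V0: "verts (X0 n) = {0..n+2}" by (simp add: X0_def)
  have parc: "is_arc (p e) e" if e: "e \<in> edges (X0 n)" for e
  proof -
    consider i where "i \<in> {1..n}" "e = {0, i}" | "e = {n-1, n+1}" | "e = {n, n+2}"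
      using e unfolding E0 by auto
    then show ?thesis
    proof cases
      case 1
      then show ?thesis unfolding is_arc_def 1(2) pe0[OF 1(1)]
        by (intro exI[of _ "B i"]) (use dB in \<open>auto simp: B_def\<close>)
    next
      case 2
      then show ?thesis unfolding is_arc_def 2 pe1 by (intro exI[of _ "[n-1, n+1]"]) auto
    next
      case 3
      then show ?thesis unfolding is_arc_def 3 pe1 by (intro exI[of _ "[n, n+2]"]) auto
    qed
  qed
  define N where "N e = (if 0 \<in> e then W (Max e) else {})" for e :: "nat set"
  have vp: "verts (p e) = e \<union> N e \<and> e \<subseteq> {0..n+2}" if "e \<in> edges (X0 n)" for e
    using that unfolding E0 by (auto simp: p_def N_def setB)
  have NV: "N e \<inter> {0..n+2} = {}" for e using W by (auto simp: N_def)
  have NN: "N d \<inter> N e = {}" if de: "d \<in> edges (X0 n)" "e \<in> edges (X0 n)" "d \<noteq> e" for d e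
  proof (cases "0 \<in> d \<and> 0 \<in> e")
    case True
    have "\<exists>i. c = {0, i}" if "c \<in> edges (X0 n)" "0 \<in> c" for c
      using that n unfolding E0 by auto
    then obtain i j where "d = {0, i}" "e = {0, j}" using True de by meson
    then show ?thesis using de WW[of i j] by (auto simp: N_def)
  qed (auto simp: N_def)
  have pint: "verts (p d) \<inter> verts (p e) = d \<inter> e"
    if "d \<in> edges (X0 n)" "e \<in> edges (X0 n)" "d \<noteq> e" for d e
    using vp[OF that(1)] vp[OF that(2)] NV[of d] NV[of e] NN[OF that] by blast
  have sub: "subdivision_arcs (X0 n) X1 p"
    by (rule subdivision_arcsI[OF is_graph_X0[OF n] parc pint]) (simp_all add: X1_def)
  have armE: "path_edges (arm0 n i) \<subseteq> edges (X0 n)" if "i \<in> {1..n}" for i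
    unfolding arm[OF that] E0 using that by (auto simp: T_def)
  have ET: "path_edges (arm0 n i) = insert {0, i} (if T i = [] then {} else {{i, hd (T i)}})" if "i \<in> {1..n}" for i
    unfolding arm[OF that] by (auto simp: T_def)
  have EA: "path_edges (A i) = path_edges (B i) \<union> (if T i = [] then {} else {{i, hd (T i)}})" if "i \<in> {1..n}" for i
  proof (cases "T i = []")
    case False
    then obtain t where t: "T i = [t]" by (auto simp: T_def split: if_splits)
    have "B i \<noteq> []" "last (B i) = i" by (simp_all add: B_def)
    then show ?thesis using path_edges_append[of "B i" "[t]"] by (simp add: A_def t)
  qed (simp add: A_def)
  have pT: "p {i, hd (T i)} = \<lparr>verts = {i, hd (T i)}, edges = {{i, hd (T i)}}\<rparr>" if "i \<in> {1..n}" "T i \<noteq> []" for i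
    using that n by (auto simp: p_def T_def split: if_splits)
  have subA: "subdivision_arcs (path_graph (arm0 n i)) (path_graph (A i)) p" if i: "i \<in> {1..n}" for i
  proof (rule subdivision_arcsI)
    have "distinct (arm0 n i)" using i T(1)[of i] T(3)[of i] by (auto simp: arm[OF i])
    then show "is_graph (path_graph (arm0 n i))" by (rule is_graph_path) (simp add: arm[OF i])
    show "is_arc (p e) e" if "e \<in> edges (path_graph (arm0 n i))" for e
      using that armE[OF i] parc by auto
    show "verts (p d) \<inter> verts (p e) = d \<inter> e"
      if "d \<in> edges (path_graph (arm0 n i))" "e \<in> edges (path_graph (arm0 n i))" "d \<noteq> e" for d e
      by (rule pint) (use that armE[OF i] in auto)
    show "verts (path_graph (A i)) = (\<Union>e\<in>edges (path_graph (arm0 n i)). verts (p e))"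
      using pT[OF i] by (simp add: ET[OF i] pe0[OF i] setA setB) (auto simp: T_def)
    show "edges (path_graph (A i)) = (\<Union>e\<in>edges (path_graph (arm0 n i)). edges (p e))"
      using pT[OF i] by (simp add: ET[OF i] EA[OF i] pe0[OF i])
  qed
  have cover: "\<exists>i\<in>{1..n}. e \<in> path_edges (arm0 n i)" if e: "e \<in> edges (X0 n)" for e
  proof -
    consider i where "i \<in> {1..n}" "e = {0, i}" | "e = {n-1, n+1}" | "e = {n, n+2}"
      using e unfolding E0 by auto
    then show ?thesis
    proof cases
      case 1
      then show ?thesis using ET by blast
    next
      case 2
      then show ?thesis using n by (intro bexI[of _ "n-1"]) (auto simp: ET T_def)
    next
      case 3
      then show ?thesis using n by (intro bexI[of _ n]) (auto simp: ET T_def)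
    qed
  qed
  have E1: "\<phi> ` c \<in> edges (X0 n)" if c: "c \<in> edges X1" for c
  proof -
    obtain e where e: "e \<in> edges (X0 n)" "c \<in> edges (p e)" using c by (auto simp: X1_def)
    obtain i where i: "i \<in> {1..n}" "e \<in> path_edges (arm0 n i)" using cover[OF e(1)] by blast
    have "edges (path_graph (A i)) = (\<Union>e\<in>edges (path_graph (arm0 n i)). edges (p e))"
      by (rule subdivision_arcsD(7)[OF subA[OF i(1)]])
    then have "c \<in> path_edges (A i)" using e i by auto
    then have "\<phi> ` c \<in> path_edges (map \<phi> (A i))" by (simp add: path_edges_map)
    then show ?thesis using phi_word_edges[OF n i(1)] mapA[OF i(1)] by auto
  qed
  have simp: "simplicial X1 (X0 n) \<phi>"
    unfolding simplicial_def
  proof (intro conjI ballI disjI1 E1)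
    show "\<phi> ` verts X1 \<subseteq> verts (X0 n)"
    proof
      fix y assume "y \<in> \<phi> ` verts X1"
      then obtain v where v: "v \<in> verts X1" "y = \<phi> v" by auto
      obtain c where c: "c \<in> edges X1" "v \<in> c"
        using graph_vertex_edge[OF subdivision_arcsD(2)[OF sub] v(1)] by blast
      then have "\<phi> ` c \<in> edges (X0 n)" by (intro E1)
      then have "\<phi> ` c \<subseteq> verts (X0 n)" using is_graph_X0[OF n] by (auto simp: is_graph_def)
      then show "y \<in> verts (X0 n)" using c v by auto
    qed
  qed
  have col: "collapses_no_edge X1 \<phi>"
    unfolding collapses_no_edge_def
  proof (intro ballI notI)
    fix c assume "c \<in> edges X1" "\<exists>v. \<phi> ` c = {v}"
    then show False using E1[of c] is_graph_X0[OF n] by (auto simp: is_graph_def)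
  qed
  have last: "set (A i) \<inter> verts (X0 n) = set (arm0 n i)" if "i \<in> {1..n}" for i
  proof -
    have "set (T i) \<subseteq> {0..n+2}" using T(1)[of i] by auto
    then show ?thesis using W[of i] that unfolding setA V0 arm[OF that] by auto
  qed
  have suf: "suffix (tl (arm0 n i)) (A i)" if "i \<in> {1..n}" for i
    by (rule suffixI[of _ "0 # map (w i) [1..<m i]"]) (simp add: arm[OF that] A_def B_def)
  have "is_phi n X1 \<phi>"
    unfolding is_phi_def using simp col sub dA A0 suf last subA mapA by blast
  then show ?thesis by blast
qed

lemma phi_sequence_exists:
  assumes n: "3 \<le> n"
  shows "\<exists>X \<psi>. phi_sequence n X \<psi>"
proof -
  obtain X1 \<phi> where phi: "is_phi n X1 \<phi>" using phi_exists[OF n] by blast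
  obtain p where p: "subdivision_arcs (X0 n) X1 p" using phi by (auto simp: is_phi_def)
  have s: "simplicial X1 (X0 n) \<phi>" "collapses_no_edge X1 \<phi>" using phi by (auto simp: is_phi_def)
  define Q where "Q G G' = (\<exists>f. matching_subdivision X1 (X0 n) \<phi> G G' f)" for G G'
  have "\<exists>Y. \<forall>k::nat. ((\<exists>q. subdivision_arcs (X0 n) (Y k) q) \<and> (k = 0 \<longrightarrow> Y k = X1)) \<and>
     Q (Y k) (Y (Suc k))"
  proof (rule dependent_nat_choice[where Q = "\<lambda>_. Q"])
    show "\<exists>x. (\<exists>q. subdivision_arcs (X0 n) x q) \<and> ((0::nat) = 0 \<longrightarrow> x = X1)" using p by blast
    fix G and k :: nat
    assume "(\<exists>q. subdivision_arcs (X0 n) G q) \<and> (k = 0 \<longrightarrow> G = X1)"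
    then obtain q where q: "subdivision_arcs (X0 n) G q" by blast
    obtain G' f r where g: "matching_subdivision X1 (X0 n) \<phi> G G' f" "subdivision_arcs X1 G' r"
      using matching_exists[OF infinite_UNIV_nat s subdivision_arcsD(2)[OF p] q] by blast
    then show "\<exists>y. ((\<exists>q. subdivision_arcs (X0 n) y q) \<and> (Suc k = 0 \<longrightarrow> y = X1)) \<and> Q G y"
      using subdivision_trans[OF p g(2)] unfolding Q_def by blast
  qed
  then obtain Y where Y: "Y 0 = X1" "\<And>k. Q (Y k) (Y (Suc k))" by blast
  then obtain f where f: "\<And>k. matching_subdivision X1 (X0 n) \<phi> (Y k) (Y (Suc k)) (f k)"
    unfolding Q_def by metis
  define X where "X i = (case i of 0 \<Rightarrow> X0 n | Suc k \<Rightarrow> Y k)" for i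
  define \<psi> where "\<psi> i = (case i of 0 \<Rightarrow> \<phi> | Suc k \<Rightarrow> f k)" for i
  have "phi_sequence n X \<psi>"
    unfolding phi_sequence_def
  proof (intro conjI allI impI)
    fix i :: nat assume "1 \<le> i"
    then obtain k where "i = Suc k" by (cases i) auto
    then show "matching_subdivision (X 1) (X 0) (\<psi> 0) (X i) (X (Suc i)) (\<psi> i)"
      using f Y(1) by (simp add: X_def \<psi>_def)
  qed (use phi Y in \<open>simp_all add: X_def \<psi>_def\<close>)
  then show ?thesis by blast
qed

end

theory Submission
  imports Defs
begin

text \<open>
  Let \<open>D\<^sub>k\<close> be the projection of a proper subcontinuum to \<open>X\<^sub>k\<close>. It is enough that for large \<open>k\<close> the
  bonding map is injective on \<open>D\<^sub>k\<close> and \<open>D\<^sub>k\<close> lies in one arm of \<open>X\<^sub>k\<close>, for then a single projection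
  followed by a coordinate on the arm embeds the continuum into the line.

  If \<open>v\<^sub>0\<close> lies in every \<open>D\<^sub>k\<close>, note that each arm starts by covering \<open>\<langle>v\<^sub>0, v\<^bsub>n-1\<^esub>\<rangle>\<close>, and that the image of
  this edge under four bonding maps is everything. Hence \<open>D\<^sub>k\<close> eventually contains no edge of \<open>X\<^sub>1\<close> at
  \<open>v\<^sub>0\<close>, so it lies in the open star of \<open>v\<^sub>0\<close>; that star is folded into \<open>\<langle>v\<^sub>0, v\<^bsub>n-1\<^esub>\<rangle>\<close>, so \<open>D\<^sub>k\<close> lies in the
  first edge of arm \<open>n - 1\<close>.

  Otherwise \<open>v\<^sub>0\<close> is eventually avoided. The vertices \<open>v\<^sub>1, \<dots>, v\<^bsub>n-1\<^esub>\<close> reach \<open>v\<^sub>n\<close> or \<open>v\<^bsub>n+2\<^esub>\<close>, both fixed, in two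
  steps. If one of them met \<open>D\<^sub>k\<close> for arbitrarily large \<open>k\<close>, every \<open>D\<^sub>k\<close> would contain \<open>v\<^sub>n\<close> or \<open>v\<^bsub>n+2\<^esub>\<close>, and
  some \<open>D\<^sub>k\<close> would have to cross \<open>v\<^sub>0\<close>. So \<open>D\<^sub>k\<close> eventually avoids all vertices at which the bonding map folds.
\<close>

section \<open>Geometric realizations of paths\<close>

text \<open>The vertex \<open>v\<close> as a point of the realization: all barycentric weight sits
  on \<open>v\<close>.\<close>

definition dirac :: "'v \<Rightarrow> 'v \<Rightarrow> real" where
  "dirac v = (\<lambda>u. if u = v then 1 else 0)"

lemma path_edges_iff_nth:
  "e \<in> path_edges xs \<longleftrightarrow> (\<exists>i. Suc i < length xs \<and> e = {xs ! i, xs ! Suc i})"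
proof (induction xs rule: path_edges.induct)
  case (1 x y xs)
  have "(\<exists>i. Suc i < length (x # y # xs) \<and> e = {(x # y # xs) ! i, (x # y # xs) ! Suc i}) \<longleftrightarrow>
    e = {x, y} \<or> (\<exists>i. Suc i < length (y # xs) \<and> e = {(y # xs) ! i, (y # xs) ! Suc i})"
    (is "?L \<longleftrightarrow> ?R")
  proof
    assume ?L
    then obtain i where "Suc i < length (x # y # xs)" "e = {(x # y # xs) ! i, (x # y # xs) ! Suc i}"
      by blast
    then show ?R by (cases i) auto
  next
    assume ?R
    then show ?L
    proof
      assume "e = {x, y}"
      then show ?L by (intro exI[of _ 0]) simp
    next
      assume "\<exists>i. Suc i < length (y # xs) \<and> e = {(y # xs) ! i, (y # xs) ! Suc i}"
      then obtain i where "Suc i < length (y # xs)" "e = {(y # xs) ! i, (y # xs) ! Suc i}" by blast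
      then show ?L by (intro exI[of _ "Suc i"]) simp
    qed
  qed
  then show ?case using 1 by simp
qed auto

lemma realization_support:
  assumes "b \<in> realization G" "\<And>e. e \<in> edges G \<Longrightarrow> e \<subseteq> verts G"
  shows "{u. b u \<noteq> 0} \<subseteq> verts G" "{u. b u \<noteq> 0} \<noteq> {}"
proof -
  have "(\<exists>v\<in>verts G. {u. b u \<noteq> 0} = {v}) \<or> {u. b u \<noteq> 0} \<in> edges G" "(\<Sum>v\<in>verts G. b v) = 1"
    using assms(1) unfolding realization_def by blast+
  then show "{u. b u \<noteq> 0} \<subseteq> verts G"
    using assms(2)[of "{u. b u \<noteq> 0}"] by (elim disjE bexE) simp_all
  have "\<not> (\<forall>v\<in>verts G. b v = 0)" using \<open>sum b (verts G) = 1\<close> by (metis sum.neutral zero_neq_one)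
  then show "{u. b u \<noteq> 0} \<noteq> {}" by auto
qed

lemma dirac_in_realization:
  assumes "finite (verts G)" "v \<in> verts G"
  shows "dirac v \<in> realization G"
  using assms unfolding realization_def by (simp add: dirac_def) 

lemma realization_mono:
  assumes "finite (verts G)" "verts H \<subseteq> verts G" "edges H \<subseteq> edges G" "\<And>e. e \<in> edges H \<Longrightarrow> e \<subseteq> verts H"
  shows "realization H \<subseteq> realization G"
proof
  fix b assume b: "b \<in> realization H"
  have "(\<Sum>v\<in>verts G. b v) = (\<Sum>v\<in>verts H. b v)"
    using assms(1,2) realization_support(1)[OF b assms(4)] by (intro sum.mono_neutral_right) auto
  then show "b \<in> realization G" using b assms(2,3) unfolding realization_def by auto
qed

lemma realization_restrict:
  assumes "finite (verts G)" "verts H \<subseteq> verts G" "b \<in> realization G"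
    and "{u. b u \<noteq> 0} \<in> edges H \<or> (\<exists>v\<in>verts H. {u. b u \<noteq> 0} = {v})"
    and "\<And>e. e \<in> edges H \<Longrightarrow> e \<subseteq> verts H"
  shows "b \<in> realization H"
proof -
  have "{u. b u \<noteq> 0} \<subseteq> verts H" using assms(4) assms(5)[of "{u. b u \<noteq> 0}"] by (elim disjE bexE) simp_all
  then have "(\<Sum>v\<in>verts G. b v) = (\<Sum>v\<in>verts H. b v)"
    using assms(1,2) by (intro sum.mono_neutral_right) auto
  then show ?thesis using assms(3,4) unfolding realization_def by auto
qed

lemma realization_singleton_support:
  assumes "b \<in> realization G" "finite (verts G)" "v \<in> verts G" "{u. b u \<noteq> 0} = {v}"
  shows "b = dirac v"
proof -
  have "(\<Sum>u\<in>verts G. b u) = (\<Sum>u\<in>{v}. b u)"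
    using assms by (intro sum.mono_neutral_right) auto
  then have "b v = 1" using assms(1) unfolding realization_def by simp
  then show ?thesis using assms(4) by (auto simp: dirac_def fun_eq_iff)
qed

text \<open>Both directions are explicit: position \<open>t\<close> on the path gets the values of
  hat functions as barycentric coordinates, and a point goes back to the mean of the vertex indices
  weighted by its coordinates. Continuity is then checked one coordinate at a time.\<close>

lemma path_realization_param:
  fixes xs :: "'v::countable list"
  assumes xs: "distinct xs" "2 \<le> length xs"
  obtains \<gamma> c where
    "homeomorphism {0..real (length xs - 1)} (realization (path_graph xs)) \<gamma> c"
    "\<gamma> 0 = dirac (hd xs)" "\<gamma> (real (length xs - 1)) = dirac (last xs)"
proof -
  define m where "m = length xs - 1"
  have len: "length xs = Suc m" "1 \<le> m" using xs by (auto simp: m_def)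
  define idx where "idx v = (THE i. i < length xs \<and> xs ! i = v)" for v
  have idx: "idx (xs ! i) = i" if "i < length xs" for i
    unfolding idx_def using that xs(1) by (intro the_equality) (auto simp: nth_eq_iff_index_eq)
  \<comment> \<open>the hat functions, so that the coordinate \<open>c\<close> inverts \<open>\<gamma>\<close>\<close>
  define \<gamma> where "\<gamma> t v = (if v \<in> set xs then max 0 (1 - \<bar>t - real (idx v)\<bar>) else 0)" for t v
  define c where "c b = (\<Sum>i<length xs. real i * b (xs ! i))" for b :: "'v \<Rightarrow> real"
  have \<gamma>nth: "\<gamma> t (xs ! i) = max 0 (1 - \<bar>t - real i\<bar>)" if "i < length xs" for t i
    using that idx by (simp add: \<gamma>_def)
  \<comment> \<open>For \<open>t = m\<close> the floor is \<open>m\<close>, where no edge starts, so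
    the last edge is taken instead.\<close>
  have split: "\<exists>i<m. real i \<le> t \<and> t \<le> real i + 1" if "t \<in> {0..real m}" for t
  proof (cases "t = real m")
    case True
    then show ?thesis using len by (intro exI[of _ "m - 1"]) (auto simp: of_nat_diff)
  next
    case False
    then show ?thesis using that by (intro exI[of _ "nat \<lfloor>t\<rfloor>"]) (auto, linarith+)
  qed
  \<comment> \<open>Only the hats centred at \<open>i\<close> and \<open>i + 1\<close> can be
    nonzero at \<open>t\<close>. Weights \<open>g = 1\<close> will give total mass one, and
    \<open>g = real\<close> will give \<open>c (\<gamma> t) = t\<close>.\<close>
  have sum_pair: "(\<Sum>j<length xs. g j * \<gamma> t (xs ! j)) = g i * (1 - (t - i)) + g (Suc i) * (t - i)"
    if i: "i < m" "real i \<le> t" "t \<le> real i + 1" for t i and g :: "nat \<Rightarrow> real"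
  proof -
    have "(\<Sum>j<length xs. g j * \<gamma> t (xs ! j)) = (\<Sum>j\<in>{i, Suc i}. g j * \<gamma> t (xs ! j))"
    proof (rule sum.mono_neutral_right)
      show "\<forall>j\<in>{..<length xs} - {i, Suc i}. g j * \<gamma> t (xs ! j) = 0"
      proof
        fix j assume j: "j \<in> {..<length xs} - {i, Suc i}"
        then have "j < i \<or> Suc i < j" by auto
        then have "1 \<le> \<bar>t - real j\<bar>"
        proof
          assume "j < i"
          then have "real j + 1 \<le> real i" by linarith
          then show ?thesis using i by linarith
        next
          assume "Suc i < j"
          then have "real i + 2 \<le> real j" by linarith
          then show ?thesis using i by linarith
        qed
        then show "g j * \<gamma> t (xs ! j) = 0" using j \<gamma>nth by simp
      qed
    qed (use i len in auto)
    also have "\<dots> = g i * (1 - (t - i)) + g (Suc i) * (t - i)"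
      using i len by (simp add: \<gamma>nth)
    finally show ?thesis .
  qed
  have supp: "{u. \<gamma> t u \<noteq> 0} \<subseteq> {xs ! i, xs ! Suc i} \<and> \<gamma> t (xs ! i) = 1 - (t - i) \<and> \<gamma> t (xs ! Suc i) = t - i"
    if i: "i < m" "real i \<le> t" "t \<le> real i + 1" for t i
  proof (intro conjI subsetI)
    fix u assume "u \<in> {u. \<gamma> t u \<noteq> 0}"
    then have u: "\<gamma> t u \<noteq> 0" by simp
    then have "u \<in> set xs" by (auto simp: \<gamma>_def split: if_splits)
    then obtain j where j: "j < length xs" "u = xs ! j" by (metis in_set_conv_nth)
    have "\<bar>t - real j\<bar> < 1" using u \<gamma>nth[OF j(1), of t] j by (auto simp: max_def split: if_splits)
    then have "real j < real i + 2" "real i < real j + 1" using i by linarith+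
    then have "j = i \<or> j = Suc i" by linarith
    then show "u \<in> {xs ! i, xs ! Suc i}" using j by auto
  qed (use i len \<gamma>nth in auto)
  have sumset: "(\<Sum>v\<in>set xs. h v) = (\<Sum>j<length xs. h (xs ! j))" for h :: "'v \<Rightarrow> real"
    using sum.reindex_bij_betw[OF bij_betw_nth[OF xs(1) refl refl], of h] by simp
  have c\<gamma>: "c (\<gamma> t) = t" if t: "t \<in> {0..real m}" for t
  proof -
    obtain i where i: "i < m" "real i \<le> t" "t \<le> real i + 1" using split[OF t] by blast
    show ?thesis using sum_pair[OF i, of real] by (simp add: c_def algebra_simps)
  qed
  have in_real: "\<gamma> t \<in> realization (path_graph xs)" if t: "t \<in> {0..real m}" for t
  proof -
    obtain i where i: "i < m" "real i \<le> t" "t \<le> real i + 1" using split[OF t] by blast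
    have "(\<Sum>v\<in>set xs. \<gamma> t v) = 1" using sum_pair[OF i, of "\<lambda>_. 1"] by (simp add: sumset)
    moreover have "(\<exists>v\<in>set xs. {u. \<gamma> t u \<noteq> 0} = {v}) \<or> {u. \<gamma> t u \<noteq> 0} \<in> path_edges xs"
    proof -
      have e: "{xs ! i, xs ! Suc i} \<in> path_edges xs" "xs ! i \<in> set xs" "xs ! Suc i \<in> set xs"
        using i len by (auto simp: path_edges_iff_nth)
      have "\<gamma> t (xs ! i) \<noteq> 0 \<or> \<gamma> t (xs ! Suc i) \<noteq> 0" using supp[OF i] by auto
      then consider "{u. \<gamma> t u \<noteq> 0} = {xs ! i}" | "{u. \<gamma> t u \<noteq> 0} = {xs ! Suc i}"
        | "{u. \<gamma> t u \<noteq> 0} = {xs ! i, xs ! Suc i}"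
        using supp[OF i] by blast
      then show ?thesis using e by cases metis+
    qed
    moreover have "0 \<le> \<gamma> t v" for v by (simp add: \<gamma>_def)
    ultimately show ?thesis by (simp add: realization_def)
  qed
  have surj: "b \<in> \<gamma> ` {0..real m}" if b: "b \<in> realization (path_graph xs)" for b
  proof -
    have "\<exists>i<m. {u. b u \<noteq> 0} \<subseteq> {xs ! i, xs ! Suc i}"
      using b unfolding realization_def
    proof (elim CollectE conjE disjE)
      assume "\<exists>v\<in>verts (path_graph xs). {u. b u \<noteq> 0} = {v}"
      then obtain v where v: "v \<in> set xs" "{u. b u \<noteq> 0} = {v}" by auto
      then obtain j where j: "j < length xs" "v = xs ! j" by (metis in_set_conv_nth)
      show ?thesis
      proof (cases "j < m")
        case False
        then have "j = Suc (m - 1)" "m - 1 < m" using j len by auto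
        then show ?thesis using v j by (intro exI[of _ "m - 1"]) auto
      qed (use v j in auto)
    next
      assume "{u. b u \<noteq> 0} \<in> edges (path_graph xs)"
      then show ?thesis using len by (auto simp: path_edges_iff_nth)
    qed
    then obtain i where i: "i < m" "{u. b u \<noteq> 0} \<subseteq> {xs ! i, xs ! Suc i}" by blast
    have ne: "xs ! i \<noteq> xs ! Suc i" using xs(1) i len by (simp add: nth_eq_iff_index_eq)
    have "(\<Sum>v\<in>set xs. b v) = (\<Sum>v\<in>{xs ! i, xs ! Suc i}. b v)"
      using i len by (intro sum.mono_neutral_right) auto
    then have s: "b (xs ! i) + b (xs ! Suc i) = 1" using b ne by (simp add: realization_def)
    have nn: "0 \<le> b v" for v using b by (simp add: realization_def)
    \<comment> \<open>The two coordinates on an edge add up to one, so the weight of the later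
      vertex is the distance from the earlier one.\<close>
    define t where "t = real i + b (xs ! Suc i)"
    have t: "real i \<le> t" "t \<le> real i + 1" using nn[of "xs ! i"] nn[of "xs ! Suc i"] s by (auto simp: t_def)
    have "b u = \<gamma> t u" for u
    proof (cases "u = xs ! i \<or> u = xs ! Suc i")
      case True
      then show ?thesis using supp[OF i(1) t] s by (auto simp: t_def)
    next
      case False
      then have "u \<notin> {u. b u \<noteq> 0}" "u \<notin> {u. \<gamma> t u \<noteq> 0}" using supp[OF i(1) t] i(2) by blast+
      then show ?thesis by simp
    qed
    moreover have "t \<in> {0..real m}" using t i(1) by auto
    ultimately show ?thesis by (intro image_eqI[of _ _ t]) auto
  qed
  have "homeomorphism {0..real m} (realization (path_graph xs)) \<gamma> c"
    unfolding homeomorphism_def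
  proof (intro conjI ballI)
    show "\<gamma> ` {0..real m} = realization (path_graph xs)" using in_real surj by auto
    show "c (\<gamma> t) = t" if "t \<in> {0..real m}" for t using c\<gamma>[OF that] .
    show "\<gamma> (c b) = b" if "b \<in> realization (path_graph xs)" for b
      using surj[OF that] c\<gamma> by auto
    show "c ` realization (path_graph xs) = {0..real m}" 
    proof -
      have "realization (path_graph xs) = \<gamma> ` {0..real m}" using in_real surj by auto
      then show ?thesis using c\<gamma> by (simp add: image_image)
    qed
    show "continuous_on {0..real m} \<gamma>"
    proof (rule continuous_on_coordinatewise_then_product)
      show "continuous_on {0..real m} (\<lambda>t. \<gamma> t v)" for v
        by (cases "v \<in> set xs") (auto simp: \<gamma>_def intro!: continuous_intros)
    qed
    show "continuous_on (realization (path_graph xs)) c"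
      unfolding c_def by (intro continuous_intros continuous_on_subset[OF continuous_on_product_coordinates]) auto
  qed
  moreover have "\<gamma> 0 = dirac (hd xs)"
  proof
    fix v
    have h: "hd xs = xs ! 0" using len by (simp add: hd_conv_nth flip: length_greater_0_conv)
    show "\<gamma> 0 v = dirac (hd xs) v"
      using supp[of 0 0] len xs(1) by (auto simp: h dirac_def nth_eq_iff_index_eq)
  qed
  moreover have "\<gamma> (real m) = dirac (last xs)"
  proof
    fix v
    have h: "last xs = xs ! m" using len by (metis diff_Suc_1 last_conv_nth length_0_conv nat.simps(3))
    have "Suc (m - 1) = m" "real (m - 1) = real m - 1" using len by (auto simp: of_nat_diff)
    then show "\<gamma> (real m) v = dirac (last xs) v"
      using supp[of "m - 1" "real m"] len xs(1) by (auto simp: h dirac_def nth_eq_iff_index_eq)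
  qed
  ultimately show ?thesis using that unfolding m_def by blast
qed

section \<open>Connected sets in subdivided graphs\<close>

context
  fixes G G' :: "'v::countable graph" and p
  assumes sub: "subdivision_arcs G G' p"
begin

lemma subdivision_finite: "finite (verts G')" "finite (edges G)"
proof -
  show "finite (verts G')" using subdivision_arcsD(2)[OF sub] by (simp add: is_graph_def)
  show "finite (edges G)"
    by (rule finite_subset[of _ "Pow (verts G)"])
      (use subdivision_arcsD(1)[OF sub] in \<open>auto simp: is_graph_def\<close>)
qed

lemma subdivision_edge: "e \<in> edges G \<Longrightarrow> e \<subseteq> verts G \<and> card e = 2"
  using subdivision_arcsD(1)[OF sub] by (simp add: is_graph_def)

lemma segment_verts: "e \<in> edges G \<Longrightarrow> verts (p e) \<subseteq> verts G'"
  and segment_edges: "e \<in> edges G \<Longrightarrow> edges (p e) \<subseteq> edges G'"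
  using subdivision_arcsD(6,7)[OF sub] by auto

lemma segment_wf:
  assumes "e \<in> edges G" "d \<in> edges (p e)"
  shows "d \<subseteq> verts (p e)"
  using is_arc_props(5)[OF subdivision_arcsD(4)[OF sub assms(1)] assms(2)] by simp

lemma segment_subset: "e \<in> edges G \<Longrightarrow> realization (p e) \<subseteq> realization G'"
  by (intro realization_mono subdivision_finite segment_verts segment_edges segment_wf)

lemma segment_param:
  assumes "{a, b} \<in> edges G"
  obtains m \<gamma> c where "0 < m" "homeomorphism {0..m::real} (realization (p {a, b})) \<gamma> c"
    "\<gamma> 0 = dirac a" "\<gamma> m = dirac b"
proof -
  have "a \<noteq> b" using subdivision_edge[OF assms] by auto
  with subdivision_arcsD(4)[OF sub assms] obtain zs where zs: "distinct zs" "2 \<le> length zs"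
    "p {a, b} = path_graph zs" "hd zs = a" "last zs = b"
    by (rule is_arc_orient)
  obtain \<gamma> c where "homeomorphism {0..real (length zs - 1)} (realization (path_graph zs)) \<gamma> c"
    "\<gamma> 0 = dirac (hd zs)" "\<gamma> (real (length zs - 1)) = dirac (last zs)"
    by (rule path_realization_param[OF zs(1,2)])
  then show ?thesis using that[of "real (length zs - 1)" \<gamma> c] zs by auto
qed

lemma segment_topology:
  assumes "e \<in> edges G"
  shows "connected (realization (p e))" "compact (realization (p e))"
proof -
  obtain a b where e: "e = {a, b}" using subdivision_edge[OF assms] by (auto simp: card_2_iff)
  obtain m \<gamma> c where "homeomorphism {0..m::real} (realization (p {a, b})) \<gamma> c"
    using segment_param[of a b] assms unfolding e by metis
  then have "continuous_on {0..m} \<gamma>" "\<gamma> ` {0..m} = realization (p e)"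
    unfolding homeomorphism_def e by auto
  then show "connected (realization (p e))" "compact (realization (p e))"
    by (metis connected_Icc connected_continuous_image, metis compact_Icc compact_continuous_image)
qed

lemma segments_closed: "D \<subseteq> edges G \<Longrightarrow> closed (\<Union>d\<in>D. realization (p d))"
  using subdivision_finite(2) segment_topology(2)
  by (intro closed_UN compact_imp_closed) (auto intro: finite_subset)

lemma segment_cover:
  assumes "b \<in> realization G'"
  shows "\<exists>e\<in>edges G. b \<in> realization (p e)"
proof -
  have "\<exists>e\<in>edges G. {u. b u \<noteq> 0} \<in> edges (p e) \<or> (\<exists>v\<in>verts (p e). {u. b u \<noteq> 0} = {v})"
    using assms subdivision_arcsD(6,7)[OF sub] unfolding realization_def by fastforce
  then show ?thesis
    using realization_restrict[OF subdivision_finite(1) segment_verts assms] segment_wf by metis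
qed

lemma segment_dirac: "e \<in> edges G \<Longrightarrow> v \<in> e \<Longrightarrow> dirac v \<in> realization (p e)"
  using is_arc_props(1,2)[OF subdivision_arcsD(4)[OF sub]] by (intro dirac_in_realization) auto

text \<open>The support of a common point lies in \<open>d \<inter> e\<close>. Two distinct edges
  share at most one vertex, so this support is a single vertex.\<close>

lemma segment_Int:
  assumes "d \<in> edges G" "e \<in> edges G" "d \<noteq> e" "b \<in> realization (p d)" "b \<in> realization (p e)"
  obtains v where "v \<in> d" "v \<in> e" "b = dirac v"
proof -
  have "{u. b u \<noteq> 0} \<subseteq> verts (p d)" "{u. b u \<noteq> 0} \<subseteq> verts (p e)" "{u. b u \<noteq> 0} \<noteq> {}"
    using realization_support[OF assms(4) segment_wf[OF assms(1)]]
      realization_support[OF assms(5) segment_wf[OF assms(2)]] by auto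
  then have s: "{u. b u \<noteq> 0} \<subseteq> d \<inter> e" "{u. b u \<noteq> 0} \<noteq> {}"
    using subdivision_arcsD(5)[OF sub assms(1-3)] by auto
  have c: "card d = 2" "card e = 2" using subdivision_edge assms by auto
  obtain v where v': "v \<in> {u. b u \<noteq> 0}" using s(2) by blast
  have "u = v" if "u \<in> {u. b u \<noteq> 0}" for u
  proof (rule ccontr)
    assume "u \<noteq> v"
    then have "card {u, v} = 2" by simp
    moreover have "{u, v} \<subseteq> d \<inter> e" using that v' s(1) by blast
    ultimately show False using card_2_Int[OF c assms(3)] by blast
  qed
  then have v: "{u. b u \<noteq> 0} = {v}" using v' by blast
  then have "v \<in> d" "v \<in> e" using s by auto
  moreover have "v \<in> verts (p d)"
    using \<open>v \<in> d\<close> is_arc_props(2)[OF subdivision_arcsD(4)[OF sub assms(1)]] by auto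
  ultimately show ?thesis
    using that realization_singleton_support[OF assms(4) is_arc_props(1)[OF subdivision_arcsD(4)[OF sub assms(1)]] _ v]
    by blast
qed

text \<open>The segments over \<open>D\<close> and those over the other edges form two closed sets
  that cover \<open>C\<close>. They meet only in vertices shared by an edge of \<open>D\<close> and
  an edge outside, and \<open>C\<close> contains none of these; hence the connected set
  \<open>C\<close> stays on one side.\<close>

lemma connected_in_segments:
  assumes "connected C" "C \<subseteq> realization G'" "D \<subseteq> edges G"
    and "x \<in> C" "d \<in> D" "x \<in> realization (p d)"
    and "\<And>d d' v. d \<in> D \<Longrightarrow> d' \<in> edges G - D \<Longrightarrow> v \<in> d \<Longrightarrow> v \<in> d' \<Longrightarrow> dirac v \<notin> C"
  shows "C \<subseteq> (\<Union>d\<in>D. realization (p d))"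
proof -
  let ?U = "\<lambda>D. \<Union>d\<in>D. realization (p d)"
  have cover: "C \<subseteq> ?U D \<union> ?U (edges G - D)" using segment_cover assms(2) by fastforce
  have "y \<notin> C" if y: "y \<in> ?U D" "y \<in> ?U (edges G - D)" for y
  proof -
    obtain d d' where d: "d \<in> D" "d' \<in> edges G - D" "y \<in> realization (p d)" "y \<in> realization (p d')"
      using y by blast
    then obtain v where "v \<in> d" "v \<in> d'" "y = dirac v"
      using segment_Int[of d d' y] assms(3) by blast
    then show ?thesis using assms(7) d by blast
  qed
  then have "?U D \<inter> ?U (edges G - D) \<inter> C = {}" by blast
  moreover have "?U D \<inter> C \<noteq> {}" using assms(4-6) by blast
  moreover have "closed (?U D)" "closed (?U (edges G - D))" using segments_closed assms(3) by auto
  ultimately have "?U (edges G - D) \<inter> C = {}" using assms(1) cover unfolding connected_closed by blast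
  then show ?thesis using cover by blast
qed

text \<open>Any \<open>z\<close> on the segment over \<open>{a, b}\<close> separates the side of \<open>B\<close> from the other side.\<close>

lemma connected_crossing:
  assumes C: "connected C" "C \<subseteq> realization G'"
    and e: "{a, b} \<in> edges G" "a \<notin> B" "b \<in> B"
    and B: "\<And>d. d \<in> edges G \<Longrightarrow> d \<noteq> {a, b} \<Longrightarrow> d \<subseteq> B \<or> d \<inter> B = {}"
    and x: "x \<in> C" "x = dirac a \<or> (\<exists>d\<in>edges G. d \<inter> B = {} \<and> x \<in> realization (p d))"
    and y: "y \<in> C" "y = dirac b \<or> (\<exists>d\<in>edges G. d \<subseteq> B \<and> y \<in> realization (p d))"
  shows "realization (p {a, b}) \<subseteq> C"
proof
  fix z assume z: "z \<in> realization (p {a, b})"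
  obtain m \<gamma> c where m: "0 < m" and h: "homeomorphism {0..m::real} (realization (p {a, b})) \<gamma> c"
    and ends: "\<gamma> 0 = dirac a" "\<gamma> m = dirac b"
    by (rule segment_param[OF e(1)])
  define t where "t = c z"
  have t: "t \<in> {0..m}" "\<gamma> t = z" using h z by (auto simp: homeomorphism_def t_def)
  have inj: "\<gamma> s = \<gamma> s' \<longleftrightarrow> s = s'" if "s \<in> {0..m}" "s' \<in> {0..m}" for s s'
    using h that by (metis homeomorphism_apply1)
  let ?L = "(\<Union>d\<in>{d\<in>edges G. d \<inter> B = {}}. realization (p d))"
  let ?R = "(\<Union>d\<in>{d\<in>edges G. d \<subseteq> B}. realization (p d))"
  have cont: "continuous_on {0..m} \<gamma>" using h by (simp add: homeomorphism_def)
  have cl: "closed (\<gamma> ` {0..t})" "closed (\<gamma> ` {t..m})"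
    using t by (intro compact_imp_closed compact_continuous_image continuous_on_subset[OF cont]; auto)+
  have img: "\<gamma> ` {0..t} \<union> \<gamma> ` {t..m} = realization (p {a, b})"
  proof -
    have "{0..t} \<union> {t..m} = {0..m}" using t by auto
    then show ?thesis using h by (metis homeomorphism_image1 image_Un)
  qed
  \<comment> \<open>Cutting the segment at \<open>z\<close> leaves two closed sets that cover
    \<open>C\<close>, with \<open>x\<close> in \<open>?P\<close> and \<open>y\<close> in
    \<open>?Q\<close>. They meet at most in \<open>z\<close>, so a connected \<open>C\<close>
    without \<open>z\<close> would be split.\<close>
  let ?P = "?L \<union> \<gamma> ` {0..t}" and ?Q = "?R \<union> \<gamma> ` {t..m}"
  have clPQ: "closed ?P" "closed ?Q" using cl segments_closed by (auto intro!: closed_Un)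
  have cov: "C \<subseteq> ?P \<union> ?Q"
  proof
    fix w assume "w \<in> C"
    then obtain d where d: "d \<in> edges G" "w \<in> realization (p d)" using segment_cover C by blast
    then show "w \<in> ?P \<union> ?Q" using B[of d] img by (cases "d = {a, b}") blast+
  qed
  have xP: "x \<in> ?P" 
  proof -
    have "dirac a \<in> \<gamma> ` {0..t}" using ends t by (metis atLeastAtMost_iff imageI order_refl)
    then show ?thesis using x(2) by blast
  qed
  have yQ: "y \<in> ?Q"
  proof -
    have "dirac b \<in> \<gamma> ` {t..m}" using ends t by (metis atLeastAtMost_iff imageI order_refl)
    then show ?thesis using y(2) by blast
  qed
  have PQ: "w = z" if w: "w \<in> ?P" "w \<in> ?Q" for w
  proof -
    \<comment> \<open>An end of the segment lies in the opposite half only if the cut is made at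
      that end.\<close>
    have ab: "dirac a \<in> \<gamma> ` {t..m} \<Longrightarrow> t = 0" "dirac b \<in> \<gamma> ` {0..t} \<Longrightarrow> t = m"
    proof -
      assume "dirac a \<in> \<gamma> ` {t..m}"
      then obtain s where "s \<in> {t..m}" "\<gamma> s = \<gamma> 0" using ends by auto
      then show "t = 0" using inj[of s 0] t m by auto
    next
      assume "dirac b \<in> \<gamma> ` {0..t}"
      then obtain s where "s \<in> {0..t}" "\<gamma> s = \<gamma> m" using ends by auto
      then show "t = m" using inj[of s m] t m by auto
    qed
    consider d d' where "d \<in> edges G" "d \<inter> B = {}" "w \<in> realization (p d)"
        "d' \<in> edges G" "d' \<subseteq> B" "w \<in> realization (p d')"
      | d where "d \<in> edges G" "d \<inter> B = {}" "w \<in> realization (p d)" "w \<in> \<gamma> ` {t..m}"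
      | d where "d \<in> edges G" "d \<subseteq> B" "w \<in> realization (p d)" "w \<in> \<gamma> ` {0..t}"
      | "w \<in> \<gamma> ` {0..t}" "w \<in> \<gamma> ` {t..m}"
      using w by blast
    then show ?thesis
    proof cases
      case 1
      have "d \<noteq> {}" using subdivision_edge[OF 1(1)] by auto
      then have "d \<noteq> d'" using 1(2,5) by blast
      then obtain v where "v \<in> d" "v \<in> d'" by (rule segment_Int[OF 1(1,4) _ 1(3,6)])
      then show ?thesis using 1 by blast
    next
      case 2
      have "d \<noteq> {a, b}" "w \<in> realization (p {a, b})" using 2 e img by auto
      then obtain v where "v \<in> d" "v \<in> {a, b}" "w = dirac v" using segment_Int[OF 2(1) e(1) _ 2(3)] by blast
      then have "w = dirac a" using 2(2) e by auto
      then show ?thesis using ab(1) 2(4) ends t by auto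
    next
      case 3
      have "d \<noteq> {a, b}" "w \<in> realization (p {a, b})" using 3 e img by auto
      then obtain v where "v \<in> d" "v \<in> {a, b}" "w = dirac v" using segment_Int[OF 3(1) e(1) _ 3(3)] by blast
      then have "w = dirac b" using 3(2) e by auto
      then show ?thesis using ab(2) 3(4) ends t by auto
    next
      case 4
      then obtain s s' where s: "s \<in> {0..t}" "s' \<in> {t..m}" "w = \<gamma> s" "w = \<gamma> s'" by auto
      then have "s = s'" using inj[of s s'] t by auto
      then show ?thesis using s t by auto
    qed
  qed
  show "z \<in> C"
  proof (rule ccontr)
    assume "z \<notin> C"
    have "?P \<inter> ?Q \<inter> C = {}"
    proof (rule equals0I)
      fix w assume w: "w \<in> ?P \<inter> ?Q \<inter> C"
      then have "w = z" by (intro PQ) simp_all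
      then show False using w \<open>z \<notin> C\<close> by simp
    qed
    moreover have "?P \<inter> C \<noteq> {}" "?Q \<inter> C \<noteq> {}" using IntI[OF xP x(1)] IntI[OF yQ y(1)] by (simp_all only: ex_in_conv[symmetric]) iprover+
    ultimately show False using C(1) clPQ cov unfolding connected_closed by meson
  qed
qed

end

section \<open>Realized simplicial maps and simple n-ods\<close>

lemma realize_map_dirac:
  assumes "finite (verts G)" "v \<in> verts G"
  shows "realize_map G f (dirac v) = dirac (f v)"
proof
  fix w
  have "realize_map G f (dirac v) w = (\<Sum>u\<in>{u\<in>verts G. f u = w}. if u = v then 1 else 0)"
    by (simp add: realize_map_def dirac_def)
  also have "\<dots> = (if v \<in> {u\<in>verts G. f u = w} then 1 else 0)"
    using assms(1) by (subst sum.delta) auto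
  also have "\<dots> = dirac (f v) w" using assms(2) by (auto simp: dirac_def)
  finally show "realize_map G f (dirac v) w = dirac (f v) w" .
qed

text \<open>\<open>f\<close> may identify vertices of \<open>G\<close>, but it is injective on
  \<open>verts P\<close>. For a point supported in \<open>P\<close> each sum in
  \<open>realize_map\<close> thus has at most one nonzero term, and the coordinates are merely
  relabelled.\<close>

lemma realize_map_iso:
  assumes fin: "finite (verts G)" and PG: "verts P \<subseteq> verts G"
    and wf: "\<And>e. e \<in> edges P \<Longrightarrow> e \<subseteq> verts P" and iso: "graph_iso P Q f"
  shows "bij_betw (realize_map G f) (realization P) (realization Q)"
proof -
  have bij: "bij_betw f (verts P) (verts Q)" and E: "edges Q = (`) f ` edges P"
    using iso by (auto simp: graph_iso_def)
  have inj: "inj_on f (verts P)" and V: "verts Q = f ` verts P" using bij by (auto simp: bij_betw_def)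
  have supp: "{u. b u \<noteq> 0} \<subseteq> verts P" if "b \<in> realization P" for b
    using realization_support(1)[OF that wf] by blast
  have val: "realize_map G f b (f v) = b v" if b: "b \<in> realization P" and v: "v \<in> verts P" for b v
  proof -
    have "(\<Sum>u\<in>{u\<in>verts G. f u = f v}. b u) = (\<Sum>u\<in>{v}. b u)"
    proof (rule sum.mono_neutral_right)
      show "\<forall>u\<in>{u \<in> verts G. f u = f v} - {v}. b u = 0"
      proof
        fix u assume u: "u \<in> {u \<in> verts G. f u = f v} - {v}"
        show "b u = 0"
        proof (rule ccontr)
          assume "b u \<noteq> 0"
          then have "u \<in> verts P" using supp[OF b] by blast
          then show False using u v inj by (auto dest: inj_onD)
        qed
      qed
    qed (use fin PG v in auto)
    then show ?thesis by (simp add: realize_map_def)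
  qed
  have out: "realize_map G f b w = 0" if b: "b \<in> realization P" and w: "w \<notin> verts Q" for b w
    unfolding realize_map_def
  proof (rule sum.neutral, rule ballI, rule ccontr)
    fix u assume u: "u \<in> {v \<in> verts G. f v = w}" "b u \<noteq> 0"
    then have "u \<in> verts P" using supp[OF b] by blast
    then show False using u w V by auto
  qed
  have into: "realize_map G f b \<in> realization Q" if b: "b \<in> realization P" for b
  proof -
    have S: "{w. realize_map G f b w \<noteq> 0} = f ` {u. b u \<noteq> 0}"
    proof
      show "{w. realize_map G f b w \<noteq> 0} \<subseteq> f ` {u. b u \<noteq> 0}"
      proof
        fix w assume w: "w \<in> {w. realize_map G f b w \<noteq> 0}"
        then have "w \<in> verts Q" using out[OF b, of w] by auto
        then obtain v where "v \<in> verts P" "w = f v" using V by auto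
        then show "w \<in> f ` {u. b u \<noteq> 0}" using w val[OF b] by auto
      qed
      show "f ` {u. b u \<noteq> 0} \<subseteq> {w. realize_map G f b w \<noteq> 0}"
        using val[OF b] supp[OF b] by auto
    qed
    have "(\<Sum>w\<in>verts Q. realize_map G f b w) = (\<Sum>v\<in>verts P. b v)"
      unfolding V using inj val[OF b] by (simp add: sum.reindex)
    moreover have "0 \<le> realize_map G f b w" for w
      using b unfolding realize_map_def realization_def by (simp add: sum_nonneg)
    moreover have "(\<exists>v\<in>verts Q. f ` {u. b u \<noteq> 0} = {v}) \<or> f ` {u. b u \<noteq> 0} \<in> edges Q"
    proof (cases "{u. b u \<noteq> 0} \<in> edges P")
      case True
      then show ?thesis using E by blast
    next
      case False
      then obtain v where "v \<in> verts P" "{u. b u \<noteq> 0} = {v}" using b unfolding realization_def by blast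
      then show ?thesis using V by auto
    qed
    ultimately show ?thesis using b S by (simp add: realization_def)
  qed
  have "inj_on (realize_map G f) (realization P)"
  proof (rule inj_onI)
    fix b b' assume b: "b \<in> realization P" "b' \<in> realization P" "realize_map G f b = realize_map G f b'"
    show "b = b'"
    proof
      fix v show "b v = b' v"
      proof (cases "v \<in> verts P")
        case True
        then show ?thesis using val b by metis
      next
        case False
        then have "v \<notin> {u. b u \<noteq> 0}" "v \<notin> {u. b' u \<noteq> 0}" using supp b by blast+
        then show ?thesis by simp
      qed
    qed
  qed
  moreover have "c \<in> realize_map G f ` realization P" if c: "c \<in> realization Q" for c
  proof -
    \<comment> \<open>The preimage of \<open>c\<close> is its pullback along \<open>f\<close>,
      extended by zero outside \<open>P\<close>.\<close>
    define b where "b v = (if v \<in> verts P then c (f v) else 0)" for v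
    have wfQ: "e \<subseteq> verts Q" if "e \<in> edges Q" for e
      using that unfolding E V by (auto dest: wf)
    have "(\<exists>v\<in>verts P. {u. b u \<noteq> 0} = {v}) \<or> {u. b u \<noteq> 0} \<in> edges P"
    proof (cases "{u. c u \<noteq> 0} \<in> edges Q")
      case True
      then obtain d where d: "d \<in> edges P" "{u. c u \<noteq> 0} = f ` d" using E by blast
      have "u \<in> {u. b u \<noteq> 0} \<longleftrightarrow> u \<in> d" for u
      proof (cases "u \<in> verts P")
        case True
        have "f u \<in> {u. c u \<noteq> 0} \<longleftrightarrow> u \<in> d"
          unfolding d(2) using inj_on_image_mem_iff[OF inj True wf[OF d(1)]] .
        then show ?thesis using True by (simp add: b_def)
      next
        case False
        then show ?thesis using wf[OF d(1)] by (auto simp: b_def)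
      qed
      then have "{u. b u \<noteq> 0} = d" by (intro set_eqI)
      then show ?thesis using d(1) by simp
    next
      case False
      then obtain w where w: "w \<in> verts Q" "{u. c u \<noteq> 0} = {w}" using c unfolding realization_def by blast
      then obtain v where v: "v \<in> verts P" "w = f v" using V by blast
      have "u \<in> {u. b u \<noteq> 0} \<longleftrightarrow> u = v" for u
      proof (cases "u \<in> verts P")
        case True
        have "f u \<in> {u. c u \<noteq> 0} \<longleftrightarrow> u = v"
          unfolding w(2) v(2) using inj_on_eq_iff[OF inj True v(1)] by simp
        then show ?thesis using True by (simp add: b_def)
      qed (use v in \<open>auto simp: b_def\<close>)
      then have "{u. b u \<noteq> 0} = {v}" by blast
      then show ?thesis using v(1) by simp
    qed
    moreover have "(\<Sum>v\<in>verts P. b v) = 1"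
      using c inj by (simp add: realization_def V b_def sum.reindex)
    moreover have "0 \<le> b v" for v using c by (simp add: b_def realization_def)
    ultimately have b: "b \<in> realization P" by (simp add: realization_def)
    have "realize_map G f b = c"
    proof
      fix w show "realize_map G f b w = c w"
      proof (cases "w \<in> verts Q")
        case True
        then obtain v where "v \<in> verts P" "w = f v" using V by blast
        then show ?thesis using val[OF b] by (simp add: b_def)
      next
        case False
        then have "w \<notin> {u. c u \<noteq> 0}" using realization_support(1)[OF c wfQ] by blast
        then show ?thesis using out[OF b False] by simp
      qed
    qed
    then show ?thesis using b by blast
  qed
  ultimately show ?thesis
    unfolding bij_betw_def by (intro conjI subset_antisym image_subsetI subsetI into) assumption+
qed

section \<open>Simple n-ods and connected sets that cross their edges\<close>

text \<open>A simple od with branch point \<open>z\<close>. Each arm is listed from \<open>z\<close>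
  outward, so that a place on an arm is a list index.\<close>

definition od_arms :: "'v graph \<Rightarrow> 'v \<Rightarrow> 'i set \<Rightarrow> ('i \<Rightarrow> 'v list) \<Rightarrow> bool" where
  "od_arms G z J L \<longleftrightarrow>
     (\<forall>j\<in>J. distinct (L j) \<and> 2 \<le> length (L j) \<and> hd (L j) = z) \<and>
     (\<forall>i\<in>J. \<forall>j\<in>J. i \<noteq> j \<longrightarrow> set (L i) \<inter> set (L j) \<subseteq> {z}) \<and>
     edges G = (\<Union>j\<in>J. path_edges (L j))"

lemma nth_in_set_drop:
  "distinct xs \<Longrightarrow> k < length xs \<Longrightarrow> xs ! k \<in> set (drop i xs) \<longleftrightarrow> i \<le> k"
proof
  assume *: "distinct xs" "k < length xs" "xs ! k \<in> set (drop i xs)"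
  then obtain l where "l < length xs - i" "xs ! k = xs ! (i + l)" by (auto simp: in_set_conv_nth)
  then have "k = i + l" using * by (auto simp: nth_eq_iff_index_eq)
  then show "i \<le> k" by simp
next
  assume *: "k < length xs" "i \<le> k"
  then have "xs ! k = drop i xs ! (k - i)" "k - i < length (drop i xs)" by auto
  then show "xs ! k \<in> set (drop i xs)" by (metis nth_mem)
qed

context
  fixes G G' :: "'v::countable graph" and p and z and J :: "'i set" and L
  assumes sub: "subdivision_arcs G G' p" and od: "od_arms G z J L"
begin

lemma od_arm: 
  assumes "j \<in> J"
  shows "distinct (L j)" "2 \<le> length (L j)" "hd (L j) = z" "L j ! 0 = z"
proof -
  show *: "distinct (L j)" "2 \<le> length (L j)" "hd (L j) = z" using od assms by (auto simp: od_arms_def)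
  then have "L j \<noteq> []" by auto
  then show "L j ! 0 = z" using *(3) by (simp add: hd_conv_nth)
qed

lemma od_edge_iff: "e \<in> edges G \<longleftrightarrow> (\<exists>j\<in>J. \<exists>i. Suc i < length (L j) \<and> e = {L j ! i, L j ! Suc i})"
  using od by (auto simp: od_arms_def path_edges_iff_nth)

lemma od_share:
  assumes "i \<in> J" "j \<in> J" "v \<in> set (L i)" "v \<in> set (L j)" "v \<noteq> z"
  shows "i = j"
  using od assms unfolding od_arms_def by blast

text \<open>Cutting edge number \<open>i\<close> of arm \<open>j\<close> detaches the outer part of
  the arm, with vertices \<open>drop (Suc i) (L j)\<close>. Another edge of this arm has a different
  index, and an edge of another arm meets arm \<open>j\<close> at most in \<open>z\<close>, which is
  not in the outer part.\<close>

lemma od_edge_side: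
  assumes j: "j \<in> J" and i: "Suc i < length (L j)" and d: "d \<in> edges G" "d \<noteq> {L j ! i, L j ! Suc i}"
  shows "d \<subseteq> set (drop (Suc i) (L j)) \<or> d \<inter> set (drop (Suc i) (L j)) = {}"
proof -
  obtain j' k where k: "j' \<in> J" "Suc k < length (L j')" "d = {L j' ! k, L j' ! Suc k}"
    using d od_edge_iff by blast
  show ?thesis
  proof (cases "j' = j")
    case True
    then have "k \<noteq> i" using k d(2) by blast
    then show ?thesis using k True od_arm(1)[OF j] by (auto simp: nth_in_set_drop)
  next
    case False
    have "z \<notin> set (drop (Suc i) (L j))"
      using nth_in_set_drop[OF od_arm(1)[OF j], of 0 "Suc i"] od_arm(4)[OF j] i by fastforce
    moreover have "set (L j') \<inter> set (drop (Suc i) (L j)) \<subseteq> {z}"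
      using od_share[OF k(1) j] False set_drop_subset by fastforce
    moreover have "d \<subseteq> set (L j')" using k by auto
    ultimately show ?thesis by blast
  qed
qed

text \<open>The alternatives with \<open>dirac\<close> admit the ends of the edge itself. They
  matter at the tip of an arm, which lies on no edge inside the outer part.\<close>

lemma od_crossing:
  assumes C: "connected C" "C \<subseteq> realization G'"
    and j: "j \<in> J" and i: "Suc i < length (L j)"
    and x: "x \<in> C" "x = dirac (L j ! i) \<or>
      (\<exists>d\<in>edges G. d \<inter> set (drop (Suc i) (L j)) = {} \<and> x \<in> realization (p d))"
    and y: "y \<in> C" "y = dirac (L j ! Suc i) \<or>
      (\<exists>d\<in>edges G. d \<subseteq> set (drop (Suc i) (L j)) \<and> y \<in> realization (p d))"
  shows "realization (p {L j ! i, L j ! Suc i}) \<subseteq> C"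
proof (rule connected_crossing[OF sub C _ _ _ _ x y])
  show "{L j ! i, L j ! Suc i} \<in> edges G" using od_edge_iff i j by blast
  show "L j ! i \<notin> set (drop (Suc i) (L j))" "L j ! Suc i \<in> set (drop (Suc i) (L j))"
    using nth_in_set_drop[OF od_arm(1)[OF j]] i by auto
qed (rule od_edge_side[OF j i])

text \<open>A vertex that is not an end of edge \<open>i\<close> lies on the next edge of the arm
  towards edge \<open>i\<close>, and that edge is on its own side of the cut. So
  \<open>od_crossing\<close> applies.\<close>

lemma od_between:
  assumes C: "connected C" "C \<subseteq> realization G'" and j: "j \<in> J"
    and k: "dirac (L j ! l) \<in> C" "dirac (L j ! k) \<in> C" "l \<le> i" "i < k" "k < length (L j)"
  shows "realization (p {L j ! i, L j ! Suc i}) \<subseteq> C"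
proof (rule od_crossing[OF C j _ k(1) _ k(2)])
  show "Suc i < length (L j)" using k by simp
  show "dirac (L j ! l) = dirac (L j ! i) \<or>
    (\<exists>d\<in>edges G. d \<inter> set (drop (Suc i) (L j)) = {} \<and> dirac (L j ! l) \<in> realization (p d))"
  proof (cases "l = i")
    case False
    let ?d = "{L j ! l, L j ! Suc l}"
    have "Suc l < length (L j)" using k by simp
    then have d: "?d \<in> edges G" using j od_edge_iff by blast
    moreover have "?d \<inter> set (drop (Suc i) (L j)) = {}"
      using False k nth_in_set_drop[OF od_arm(1)[OF j]] by auto
    ultimately show ?thesis using segment_dirac[OF sub d] by blast
  qed simp
  show "dirac (L j ! k) = dirac (L j ! Suc i) \<or>
    (\<exists>d\<in>edges G. d \<subseteq> set (drop (Suc i) (L j)) \<and> dirac (L j ! k) \<in> realization (p d))"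
  proof (cases "k = Suc i")
    case False
    then obtain k' where k': "k = Suc k'" "Suc i \<le> k'" using k by (cases k) auto
    let ?d = "{L j ! k', L j ! Suc k'}"
    have d: "?d \<in> edges G" using j k k' od_edge_iff by blast
    moreover have "?d \<subseteq> set (drop (Suc i) (L j))"
      using k k' nth_in_set_drop[OF od_arm(1)[OF j]] by auto
    ultimately show ?thesis using segment_dirac[OF sub d] k' by blast
  qed simp
qed

text \<open>The segments over one arm join to a single path of \<open>G'\<close>, and
  \<open>c\<close> is the coordinate on this path. It will embed the subcontinuum in the
  line.\<close>

lemma od_arm_embedding:
  assumes j: "j \<in> J"
  obtains c :: "('v \<Rightarrow> real) \<Rightarrow> real" where
    "continuous_on (\<Union>d\<in>path_edges (L j). realization (p d)) c"
    "inj_on c (\<Union>d\<in>path_edges (L j). realization (p d))"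
proof -
  have E: "path_edges (L j) \<subseteq> edges G" using od j by (auto simp: od_arms_def)
  have "\<exists>ys. distinct ys \<and> 2 \<le> length ys \<and> hd ys = hd (L j) \<and> last ys = last (L j) \<and>
    set ys = (\<Union>e\<in>path_edges (L j). verts (p e)) \<and> path_edges ys = (\<Union>e\<in>path_edges (L j). edges (p e))"
    using subdivision_arcsD(4,5)[OF sub] E od_arm[OF j] by (intro subdivide_path) blast+
  then obtain ys where ys: "distinct ys" "2 \<le> length ys"
    "set ys = (\<Union>e\<in>path_edges (L j). verts (p e))" "path_edges ys = (\<Union>e\<in>path_edges (L j). edges (p e))"
    by blast
  obtain \<gamma> c where h: "homeomorphism {0..real (length ys - 1)} (realization (path_graph ys)) \<gamma> c"
    by (rule path_realization_param[OF ys(1,2)])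
  have "(\<Union>d\<in>path_edges (L j). realization (p d)) \<subseteq> realization (path_graph ys)"
  proof (rule UN_least, rule realization_mono)
    fix d assume d: "d \<in> path_edges (L j)"
    show "verts (p d) \<subseteq> verts (path_graph ys)" "edges (p d) \<subseteq> edges (path_graph ys)"
      unfolding path_graph_simps ys(3,4) using d by (rule UN_upper)+
    show "e \<subseteq> verts (p d)" if "e \<in> edges (p d)" for e
      by (rule segment_wf[OF sub subsetD[OF E d] that])
  qed simp
  moreover have "continuous_on (realization (path_graph ys)) c" "inj_on c (realization (path_graph ys))"
    using h by (auto simp: homeomorphism_def intro: inj_on_inverseI)
  ultimately show ?thesis by (intro that[of c]) (rule continuous_on_subset inj_on_subset, assumption+)+
qed

end

section \<open>The inverse sequence\<close>

lemma od_arms_X0: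
  assumes n: "3 \<le> n"
  shows "od_arms (X0 n) 0 {1..n} (arm0 n)"
proof -
  have "edges (X0 n) = (\<Union>j\<in>{1..n}. path_edges (arm0 n j))"
  proof
    show "edges (X0 n) \<subseteq> (\<Union>j\<in>{1..n}. path_edges (arm0 n j))"
    proof
      fix e assume "e \<in> edges (X0 n)"
      then consider i where "i \<in> {1..n}" "e = {0, i}" | "e = {n-1, n+1}" | "e = {n, n+2}"
        by (auto simp: X0_def)
      then show "e \<in> (\<Union>j\<in>{1..n}. path_edges (arm0 n j))"
      proof cases
        case 1
        then show ?thesis by (intro UN_I[of i]) (auto simp: arm0_def)
      next
        case 2
        then show ?thesis using n by (intro UN_I[of "n-1"]) (auto simp: arm0_def)
      next
        case 3
        then show ?thesis using n by (intro UN_I[of n]) (auto simp: arm0_def)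
      qed
    qed
    show "(\<Union>j\<in>{1..n}. path_edges (arm0 n j)) \<subseteq> edges (X0 n)"
    proof (rule UN_least)
      fix j assume j: "j \<in> {1..n}"
      consider "j = n - 1" | "j = n" | "j \<noteq> n - 1" "j \<noteq> n" by blast
      then show "path_edges (arm0 n j) \<subseteq> edges (X0 n)"
        by cases (use j n in \<open>auto simp: arm0_def X0_def\<close>)
    qed
  qed
  then show ?thesis using n by (auto simp: od_arms_def arm0_def)
qed

section \<open>The vertex words of the arms\<close>

text \<open>Separates the part of a word where folds can occur from its tail \<open>0, a, b\<close>,
  whose two edges have different images and are not folded onto each other.\<close>

lemma phi_word_split:
  assumes n: "3 \<le> n" and j: "j \<in> {1..n}"
  obtains u a b where "phi_word n j = u @ [0, a, b]" "\<forall>v\<in>set u. v < n"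
    "b \<noteq> 0" "{0, a} \<in> edges (X0 n)" "{a, b} \<in> edges (X0 n)"
proof -
  have E: "{0, n-1} \<in> edges (X0 n)" "{n-1, n+1} \<in> edges (X0 n)"
    "{0, n} \<in> edges (X0 n)" "{n, n+2} \<in> edges (X0 n)"
    using n by (auto simp: X0_def)
  consider "j = n - 2" | "j = n - 1" | "j = n" | "j \<noteq> n-2" "j \<noteq> n-1" "j \<noteq> n" by blast
  then show thesis
  proof cases
    case 1
    then show ?thesis using E by (intro that[of "[]" "n-1" "n+1"]) (simp_all add: phi_word_def)
  next
    case 2
    then show ?thesis using n E by (intro that[of "[0, n-1]" "n" "n+2"]) (auto simp: phi_word_def)
  next
    case 3
    then show ?thesis using n E
      by (intro that[of "[0, n-1, 0, n-2] @ concat (map (\<lambda>j. [0, j]) [1..<n-2])" "n" "n+2"])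
        (auto simp: phi_word_def split: if_splits)
  next
    case 4
    have "residue_index n k < n" for k using residue_index_bounds(2)[OF n, of k] n by linarith
    then show ?thesis using 4 n E
      by (intro that[of "[0, n-1] @ concat (map (\<lambda>k. [0, residue_index n (j+k)]) [0..<n-2])" "n" "n+2"])
        (auto simp: phi_word_def)
  qed
qed

lemma phi_word_end:
  assumes n: "3 \<le> n" and j: "j = n - 1 \<or> j = n"
  obtains us where "phi_word n j = us @ [n, n + 2]"
  using j
proof
  assume "j = n - 1"
  then show thesis using n by (intro that[of "[0, n-1, 0]"]) (auto simp: phi_word_def)
next
  assume "j = n"
  then show thesis using n
    by (intro that[of "[0, n-1, 0, n-2] @ concat (map (\<lambda>j. [0, j]) [1..<n-2]) @ [0]"]) (auto simp: phi_word_def)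
qed

lemma phi_word_nth:
  assumes "3 \<le> n"
  shows "phi_word n j ! 0 = 0" "phi_word n j ! 1 = n - 1" "3 \<le> length (phi_word n j)"
  by (auto simp: phi_word_def)

text \<open>\<open>Y k\<close> is the paper's \<open>X\<^bsub>k+1\<^esub>\<close> and \<open>f k\<close> is \<open>\<psi>\<^bsub>k+1\<^esub>\<close>. The arcs of \<open>Y k\<close> over the edges of \<open>X\<^sub>0\<close> are
  \<open>p k\<close>; those of \<open>Y (k+1)\<close> over the edges of \<open>X\<^sub>1\<close> are \<open>q k\<close>. The two families come from different
  matchings; \<open>segment_refine\<close> relates them by connectedness, which avoids proving that subdivision
  arcs are unique.\<close>

locale phi_tower =
  fixes n :: nat and X1 :: "nat graph" and \<phi> :: "nat \<Rightarrow> nat" and Y :: "nat \<Rightarrow> nat graph"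
    and f :: "nat \<Rightarrow> nat \<Rightarrow> nat" and p q :: "nat \<Rightarrow> nat set \<Rightarrow> nat graph" and L :: "nat \<Rightarrow> nat list"
  assumes n: "3 \<le> n"
    and p: "\<And>k. subdivision_arcs (X0 n) (Y k) (p k)"
    and q: "\<And>k. subdivision_arcs X1 (Y (Suc k)) (q k)"
    and iso: "\<And>k d. d \<in> edges X1 \<Longrightarrow> graph_iso (q k d) (p k (\<phi> ` d)) (f k)"
    and agree: "\<And>k v. v \<in> verts X1 \<Longrightarrow> f k v = \<phi> v"
    and od: "od_arms X1 0 {1..n} L"
    and suf: "\<And>j. j \<in> {1..n} \<Longrightarrow> suffix (tl (arm0 n j)) (L j)"
    and word: "\<And>j. j \<in> {1..n} \<Longrightarrow> map \<phi> (L j) = phi_word n j"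
begin

abbreviation "S k e \<equiv> realization (p k e)"
abbreviation "S' k d \<equiv> realization (q k d)"
abbreviation "F k \<equiv> realize_map (Y (Suc k)) (f k)"

lemma edges_X0: "{0, j} \<in> edges (X0 n)" if "1 \<le> j" "j \<le> n" for j
  using that by (auto simp: X0_def)

text \<open>The whole segment over an edge of \<open>X1\<close> is carried isomorphically to a
  segment over an edge of \<open>X0 n\<close>, so a bonding map can fold only at vertices of
  \<open>X1\<close>.\<close>

lemma F_bij: "d \<in> edges X1 \<Longrightarrow> bij_betw (F k) (S' k d) (S k (\<phi> ` d))"
  by (intro realize_map_iso iso subdivision_finite(1)[OF q] segment_verts[OF q] segment_wf[OF q])

lemma F_dirac:
  assumes "v \<in> verts X1"
  shows "F k (dirac v) = dirac (\<phi> v)"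
proof -
  have "v \<in> verts (Y (Suc k))" using subdivision_arcsD(3)[OF q] assms by blast
  then show ?thesis
    using realize_map_dirac[OF subdivision_finite(1)[OF q]] agree[OF assms] by metis
qed

lemma arm:
  assumes "j \<in> {1..n}"
  shows "distinct (L j)" "L j ! 0 = 0" "length (L j) = length (phi_word n j)" "3 \<le> length (L j)"
    "set (L j) \<subseteq> verts X1"
    "i < length (L j) \<Longrightarrow> \<phi> (L j ! i) = phi_word n j ! i"
proof -
  show "distinct (L j)" "L j ! 0 = 0" using od_arm[OF q od assms] by auto
  show len: "length (L j) = length (phi_word n j)" using word[OF assms] by (metis length_map)
  then show "3 \<le> length (L j)" using phi_word_nth[OF n] by simp
  then have c: "\<Union> (path_edges (L j)) = set (L j)" by (intro path_edges_cover) simp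
  have "path_edges (L j) \<subseteq> edges X1" using od assms by (auto simp: od_arms_def)
  then show "set (L j) \<subseteq> verts X1" using c subdivision_edge[OF q[of 0]] by blast
  show "i < length (L j) \<Longrightarrow> \<phi> (L j ! i) = phi_word n j ! i"
    using word[OF assms] by (metis nth_map)
qed

lemma arm_edge:
  assumes "j \<in> {1..n}" "Suc i < length (L j)"
  shows "{L j ! i, L j ! Suc i} \<in> edges X1"
  using assms od_edge_iff[OF q od] by blast

text \<open>Only the arms \<open>n - 1\<close> and \<open>n\<close> of \<open>X0 n\<close> have a
  second edge. It ends at \<open>n + 1\<close> and \<open>n + 2\<close> respectively, which is
  \<open>j + 2\<close> in both cases.\<close>

lemma arm_split:
  assumes "j \<in> {1..n}"
  shows "\<exists>zs. L j = zs @ j # (if n - 1 \<le> j then [j + 2] else [])"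
proof -
  have t: "tl (arm0 n j) = j # (if n - 1 \<le> j then [j + 2] else [])"
    using assms n by (auto simp: arm0_def)
  then show ?thesis using suf[OF assms] by (simp add: suffix_def)
qed

section \<open>Comparison of the segments over \<open>X1\<close> with those over
  \<open>X0 n\<close>\<close>

text \<open>The segment over \<open>{0, j}\<close> is connected and contains the vertices
  \<open>0\<close> and \<open>j\<close> of arm \<open>j\<close>. By \<open>od_between\<close> it
  contains every segment of the finer family between them.\<close>

lemma segment_refine:
  assumes j: "j \<in> {1..n}" "L j = zs @ j # ts" and d: "d \<in> path_edges (zs @ [j])"
  shows "S' k d \<subseteq> S (Suc k) {0, j}"
proof -
  have e: "{0, j} \<in> edges (X0 n)" using j edges_X0 by simp
  obtain i where i: "i < length zs" "d = {(zs @ [j]) ! i, (zs @ [j]) ! Suc i}"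
    using d by (auto simp: path_edges_iff_nth)
  have [simp]: "(zs @ [j]) ! l = L j ! l" if "l \<le> length zs" for l
    using that by (auto simp: j(2) nth_append)
  have "realization (q k {L j ! i, L j ! Suc i}) \<subseteq> S (Suc k) {0, j}"
  proof (rule od_between[OF q od _ _ j(1), of _ _ 0 "length zs"])
    show "connected (S (Suc k) {0, j})" by (rule segment_topology[OF p e])
    show "S (Suc k) {0, j} \<subseteq> realization (Y (Suc k))" by (rule segment_subset[OF p e])
    show "dirac (L j ! 0) \<in> S (Suc k) {0, j}"
      using arm(2)[OF j(1)] segment_dirac[OF p e] by auto
    show "dirac (L j ! length zs) \<in> S (Suc k) {0, j}"
      using segment_dirac[OF p e] by (auto simp: j(2))
  qed (use i j in auto)
  then show ?thesis using i by simp
qed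

lemma segment_refine_end:
  assumes j: "j \<in> {1..n}" "n - 1 \<le> j"
  shows "S' k {j, j + 2} \<subseteq> S (Suc k) {j, j + 2}" "{j, j + 2} \<in> edges X1" "\<phi> ` {j, j + 2} = {n, n + 2}"
proof -
  obtain zs where zs: "L j = zs @ [j, j + 2]" using arm_split[OF j(1)] j(2) by auto
  have [simp]: "L j ! length zs = j" "L j ! Suc (length zs) = j + 2" by (auto simp: zs nth_append)
  have len: "Suc (length zs) < length (L j)" by (simp add: zs)
  have e: "{j, j + 2} \<in> edges (X0 n)"
  proof -
    have "j = n - 1 \<or> j = n" using j by auto
    then show ?thesis using n by (auto simp: X0_def)
  qed
  show "{j, j + 2} \<in> edges X1" using arm_edge[OF j(1) len] by simp
  have "realization (q k {L j ! length zs, L j ! Suc (length zs)}) \<subseteq> S (Suc k) {j, j + 2}"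
  proof (rule od_between[OF q od _ _ j(1), of _ _ "length zs" "Suc (length zs)"])
    show "connected (S (Suc k) {j, j + 2})" by (rule segment_topology[OF p e])
    show "S (Suc k) {j, j + 2} \<subseteq> realization (Y (Suc k))" by (rule segment_subset[OF p e])
  qed (use len segment_dirac[OF p e] in auto)
  then show "S' k {j, j + 2} \<subseteq> S (Suc k) {j, j + 2}" by simp
  have "j = n - 1 \<or> j = n" using j by auto
  then obtain us where "phi_word n j = us @ [n, n + 2]" by (rule phi_word_end[OF n])
  then have "map \<phi> zs @ [\<phi> j, \<phi> (j + 2)] = us @ [n, n + 2]" using word[OF j(1)] zs by auto
  then show "\<phi> ` {j, j + 2} = {n, n + 2}" by (auto simp: append_eq_append_conv)
qed

text \<open>Every vertex of \<open>X0 n\<close> other than \<open>0\<close> is last or next to last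
  on an arm of \<open>X1\<close>, so its image is read off from the end of a word. Under iteration
  all of them reach one of the fixed vertices \<open>n\<close> and \<open>n + 2\<close>.\<close>

lemma phi_ends:
  shows "\<lbrakk>1 \<le> j; j < n - 2\<rbrakk> \<Longrightarrow> \<phi> j = n + 2" "\<phi> (n - 2) = n + 1" "\<phi> (n - 1) = n" "\<phi> n = n"
    "\<phi> (n + 1) = n + 2" "\<phi> (n + 2) = n + 2"
    "1 \<le> i \<Longrightarrow> i \<le> n + 2 \<Longrightarrow> i \<in> verts X1" "0 \<in> verts X1" "\<phi> 0 = 0"
proof -
  have l: "\<phi> j = last (phi_word n j)" if "1 \<le> j" "j \<le> n - 2" for j
  proof -
    have j: "j \<in> {1..n}" "\<not> n - 1 \<le> j" using that n by auto
    obtain zs where "L j = zs @ [j]" using arm_split[OF j(1)] j(2) by auto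
    then have "phi_word n j = map \<phi> zs @ [\<phi> j]" using word[OF j(1)] by simp
    then show ?thesis by simp
  qed
  show "\<phi> j = n + 2" if "1 \<le> j" "j < n - 2"
  proof -
    have "j \<noteq> n - 2" "j \<noteq> n - 1" "j \<noteq> n" using that by auto
    then have "last (phi_word n j) = n + 2" by (simp add: phi_word_def)
    then show ?thesis using l[of j] that by simp
  qed
  show "\<phi> (n - 2) = n + 1" using l[of "n - 2"] n by (simp add: phi_word_def)
  have m: "\<phi> j = n \<and> \<phi> (j + 2) = n + 2 \<and> j + 2 \<in> verts X1" if j: "j \<in> {n-1, n}" for j
  proof -
    have j': "j \<in> {1..n}" "n - 1 \<le> j" using j n by auto
    obtain zs where zs: "L j = zs @ [j, j + 2]" using arm_split[OF j'(1)] j' by auto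
    have "j = n - 1 \<or> j = n" using j by auto
    then obtain us where "phi_word n j = us @ [n, n + 2]" by (rule phi_word_end[OF n])
    then have "map \<phi> zs @ [\<phi> j, \<phi> (j + 2)] = us @ [n, n + 2]" using word[OF j'(1)] zs by auto
    then show ?thesis using arm(5)[OF j'(1)] zs by auto
  qed
  show "\<phi> (n - 1) = n" "\<phi> n = n" "\<phi> (n + 2) = n + 2" using m by auto
  have "n - 1 + 2 = n + 1" using n by simp
  then show "\<phi> (n + 1) = n + 2" using m[of "n - 1"] by simp
  have v: "j \<in> verts X1" if "j \<in> {1..n}" for j
  proof -
    have "j \<in> set (L j)" using arm_split[OF that] by (metis in_set_conv_decomp)
    then show ?thesis using arm(5)[OF that] by blast
  qed
  show "1 \<le> i \<Longrightarrow> i \<le> n + 2 \<Longrightarrow> i \<in> verts X1"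
  proof -
    assume "1 \<le> i" "i \<le> n + 2"
    then consider "i \<in> {1..n}" | "i = n - 1 + 2" | "i = n + 2" using n by fastforce
    then show ?thesis using v[of i] m[of "n - 1"] m[of n] by cases auto
  qed
  have one: "1 \<in> {1..n}" using n by simp
  have "0 < length (L 1)" using arm(4)[OF one] by linarith
  then show "0 \<in> verts X1" "\<phi> 0 = 0"
    using arm(2)[OF one] subsetD[OF arm(5)[OF one] nth_mem, of 0] arm(6)[OF one, of 0]
      phi_word_nth(1)[OF n, of 1] by simp_all
qed

end

section \<open>Projections of a subcontinuum\<close>

text \<open>\<open>D k\<close> is the projection of a subcontinuum to \<open>Y k\<close>. Properness
  enters later, as an inequality between \<open>D k\<close> and the whole realization.\<close>

locale phi_tower_continuum = phi_tower +
  fixes D :: "nat \<Rightarrow> (nat \<Rightarrow> real) set"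
  assumes D_sub: "\<And>k. D k \<subseteq> realization (Y k)"
    and D_conn: "\<And>k. connected (D k)"
    and D_ne: "\<And>k. D k \<noteq> {}"
    and D_map: "\<And>k. F k ` D (Suc k) = D k"
begin

section \<open>Projections that contain the branch point\<close>

lemma D_segment:
  assumes "d \<in> edges X1" "S' k d \<subseteq> D (Suc k)"
  shows "S k (\<phi> ` d) \<subseteq> D k"
proof -
  have "F k ` S' k d = S k (\<phi> ` d)" using F_bij[OF assms(1)] by (simp add: bij_betw_def)
  then show ?thesis using assms(2) D_map by blast
qed

lemma D_dirac: "v \<in> verts X1 \<Longrightarrow> dirac v \<in> D (Suc k) \<Longrightarrow> dirac (\<phi> v) \<in> D k"
  using F_dirac[of v k] D_map[of k] imageI[of "dirac v" "D (Suc k)" "F k"] by simp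

text \<open>Arm \<open>j\<close> of \<open>X1\<close> up to the vertex \<open>j\<close> subdivides
  \<open>{0, j}\<close>, so its image runs through the word of the arm. On the arms
  \<open>n - 1\<close> and \<open>n\<close> the last edge lies over the outer edge instead, hence
  \<open>butlast\<close>.\<close>

lemma D_arm_segment:
  assumes j: "j \<in> {1..n}" and D: "S (Suc k) {0, j} \<subseteq> D (Suc k)"
    and e: "e \<in> path_edges (if n - 1 \<le> j then butlast (phi_word n j) else phi_word n j)"
  shows "S k e \<subseteq> D k"
proof -
  obtain zs where zs: "L j = zs @ j # (if n - 1 \<le> j then [j + 2] else [])"
    using arm_split[OF j] by blast
  then have "map \<phi> (zs @ [j]) = (if n - 1 \<le> j then butlast (phi_word n j) else phi_word n j)"
    using word[OF j] by (auto simp: butlast_append simp flip: word[OF j])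
  then have "e \<in> (`) \<phi> ` path_edges (zs @ [j])" using e by (simp only: path_edges_map[symmetric])
  then obtain d where d: "d \<in> path_edges (zs @ [j])" "e = \<phi> ` d" by blast
  have "path_edges (zs @ [j]) \<subseteq> path_edges (L j)"
    using path_edges_append[of "zs @ [j]" "[j + 2]"] by (auto simp: zs)
  then have "d \<in> edges X1" using d(1) od j by (auto simp: od_arms_def)
  moreover have "S' k d \<subseteq> D (Suc k)" using segment_refine[OF j zs d(1)] D by blast
  ultimately show ?thesis using D_segment d(2) by blast
qed

text \<open>The edge \<open>{0, n - 1}\<close> reproduces itself at each lower level. One level down
  it yields \<open>{0, n}\<close>, after two levels every \<open>{0, j}\<close>, after three
  \<open>{n - 1, n + 1}\<close> through the word of arm \<open>n - 2\<close>, and after four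
  \<open>{n, n + 2}\<close>.\<close>

lemma D_full:
  assumes "S (k + 4) {0, n - 1} \<subseteq> D (k + 4)"
  shows "D k = realization (Y k)"
proof -
  have h1: "S k {0, n - 1} \<subseteq> D k \<and> S k {0, n} \<subseteq> D k"
    if "S (Suc k) {0, n - 1} \<subseteq> D (Suc k)" for k
  proof -
    have "phi_word n (n - 1) = [0, n - 1, 0, n, n + 2]" using n by (auto simp: phi_word_def)
    moreover have "n - 1 \<in> {1..n}" using n by auto
    ultimately show ?thesis using D_arm_segment[OF _ that] by simp
  qed
  have h2: "S k {0, j} \<subseteq> D k"
    if D: "S (Suc k) {0, n} \<subseteq> D (Suc k)" and j: "1 \<le> j" "j \<le> n - 2" for k j
  proof -
    have w: "butlast (phi_word n n) = [0, n-1, 0, n-2] @ concat (map (\<lambda>j. [0, j]) [1..<n-2]) @ [0, n]"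
    proof -
      have "n \<noteq> n - 1" "n \<noteq> n - 2" using n by auto
      then show ?thesis by (simp add: phi_word_def butlast_append)
    qed
    have "{0, j} \<in> path_edges (butlast (phi_word n n))"
    proof (cases "j = n - 2")
      case True
      then show ?thesis unfolding w by simp
    next
      case False
      \<comment> \<open>Splitting the word in front of the entry \<open>j\<close> exhibits the edge
        from the preceding \<open>0\<close> to \<open>j\<close>.\<close>
      then have "[1..<n-2] = [1..<j] @ j # [Suc j..<n-2]"
        using j upt_add_eq_append[of 1 j "n - 2 - j"] upt_conv_Cons[of j "n-2"] by simp
      then have *: "butlast (phi_word n n) =
        ([0, n-1, 0, n-2] @ concat (map (\<lambda>j. [0, j]) [1..<j]) @ [0]) @
        (j # concat (map (\<lambda>j. [0, j]) [Suc j..<n-2]) @ [0, n])"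
        unfolding w by simp
      have "{last xs, hd ys} \<in> path_edges (xs @ ys)" if "xs \<noteq> []" "ys \<noteq> []" for xs ys :: "nat list"
        using path_edges_append[OF that] by simp
      from this[of "[0, n-1, 0, n-2] @ concat (map (\<lambda>j. [0, j]) [1..<j]) @ [0]"
          "j # concat (map (\<lambda>j. [0, j]) [Suc j..<n-2]) @ [0, n]"]
      show ?thesis unfolding * by simp
    qed
    then show ?thesis using n by (intro D_arm_segment[OF _ D]) auto
  qed
  have h3: "S k {n - 1, n + 1} \<subseteq> D k"
    if D: "S (Suc k) {0, n - 2} \<subseteq> D (Suc k)" for k
  proof (rule D_arm_segment[OF _ D])
    show "n - 2 \<in> {1..n}" using n by auto
    show "{n - 1, n + 1} \<in> path_edges (if n - 1 \<le> n - 2 then butlast (phi_word n (n - 2)) else phi_word n (n - 2))"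
      using n by (auto simp: phi_word_def)
  qed
  have h4: "S k {n, n + 2} \<subseteq> D k" if D: "S (Suc k) {n - 1, n + 1} \<subseteq> D (Suc k)" for k
  proof -
    have *: "n - 1 + 2 = n + 1" "n - 1 \<in> {1..n}" "n - 1 \<le> n - 1" using n by auto
    note r = segment_refine_end[OF *(2,3), unfolded *(1)]
    have "S' k {n - 1, n + 1} \<subseteq> D (Suc k)" using r(1)[of k] D by blast
    then show ?thesis using D_segment[OF r(2)] r(3) by metis
  qed
  have "S (Suc (Suc (Suc (Suc k)))) {0, n - 1} \<subseteq> D (Suc (Suc (Suc (Suc k))))"
    using assms by (simp add: eval_nat_numeral)
  note a3 = h1[OF this]
  note a2 = h1[OF conjunct1[OF a3]] h2[OF conjunct2[OF a3]]
  have "S (Suc (Suc k)) {0, n - 2} \<subseteq> D (Suc (Suc k))" using n by (intro a2(2)) auto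
  note b1 = h3[OF this]
  note a1 = h1[OF conjunct1[OF a2(1)]] h2[OF conjunct2[OF a2(1)]]
  have "S (Suc k) {0, n - 2} \<subseteq> D (Suc k)" using n by (intro a1(2)) auto
  note b0 = h3[OF this] h4[OF b1]
  note a0 = h1[OF conjunct1[OF a1(1)]] h2[OF conjunct2[OF a1(1)]]
  have "S k e \<subseteq> D k" if e: "e \<in> edges (X0 n)" for e
  proof -
    consider i where "1 \<le> i" "i \<le> n - 2" "e = {0, i}" | "e = {0, n - 1}" | "e = {0, n}"
      | "e = {n-1, n+1}" | "e = {n, n+2}"
    proof -
      consider i where "1 \<le> i" "i \<le> n" "e = {0, i}" | "e = {n-1, n+1}" | "e = {n, n+2}"
        using e by (auto simp: X0_def)
      then show thesis
      proof cases
        case 1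
        then consider "i \<le> n - 2" | "i = n - 1" | "i = n" by linarith
        then show ?thesis by cases (use 1 that in blast)+
      qed (use that in auto)
    qed
    then show ?thesis by cases (use a0 b0 in simp_all)
  qed
  then show ?thesis using D_sub[of k] segment_cover[OF p, of _ k] by blast
qed

text \<open>First \<open>D (Suc k)\<close> is confined to the first edges of the arms of
  \<open>X1\<close>. All of these are mapped onto \<open>{0, n - 1}\<close>, which confines the
  projections to the segment over this edge too, and the two restrictions leave only arm
  \<open>n - 1\<close>.\<close>

lemma D_star:
  assumes z: "\<And>k. dirac 0 \<in> D k" and proper: "\<And>k. m \<le> k \<Longrightarrow> D k \<noteq> realization (Y k)"
    and k: "m + 5 \<le> k"
  shows "D (Suc k) \<subseteq> S' k {0, L (n - 1) ! 1}"
proof -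
  have first: "{0, L j ! 1} \<in> edges X1" "\<phi> ` {0, L j ! 1} = {0, n - 1}"
    "{0, L j ! 1} = {L j ! 0, L j ! Suc 0}" if "j \<in> {1..n}" for j
  proof -
    show *: "{0, L j ! 1} = {L j ! 0, L j ! Suc 0}" using arm(2)[OF that] by simp
    show "{0, L j ! 1} \<in> edges X1" using arm_edge[OF that, of 0] arm(4)[OF that] unfolding * by simp
    show "\<phi> ` {0, L j ! 1} = {0, n - 1}"
      using arm(4)[OF that] arm(6)[OF that, of 1] phi_word_nth[OF n, of j] phi_ends(9) by simp
  qed
  have star: "\<exists>j\<in>{1..n}. x \<in> S' k {0, L j ! 1}" if k: "m + 4 \<le> k" and x: "x \<in> D (Suc k)" for k x
  proof -
    obtain d where d: "d \<in> edges X1" "x \<in> S' k d" using segment_cover[OF q] D_sub x by blast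
    then obtain j i where ji: "j \<in> {1..n}" "Suc i < length (L j)" "d = {L j ! i, L j ! Suc i}"
      using od_edge_iff[OF q od] by blast
    show ?thesis
    proof (cases "i = 0")
      case True
      then show ?thesis using d ji first(3)[OF ji(1)] by (intro bexI[of _ j]) auto
    next
      case False
      \<comment> \<open>Here \<open>x\<close> lies beyond the first edge of arm \<open>j\<close>
        while \<open>0\<close> is also in the projection, so that edge is covered. Its image is
        \<open>{0, n - 1}\<close>, and four levels lower the projection would be everything.\<close>
      have "realization (q k {L j ! 0, L j ! Suc 0}) \<subseteq> D (Suc k)"
      proof (rule od_crossing[OF q od D_conn D_sub ji(1) _ z _ x])
        show "dirac 0 = dirac (L j ! 0) \<or>
          (\<exists>d\<in>edges X1. d \<inter> set (drop (Suc 0) (L j)) = {} \<and> dirac 0 \<in> S' k d)"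
          using arm(2)[OF ji(1)] by simp
        have "d \<subseteq> set (drop (Suc 0) (L j))"
          using False ji nth_in_set_drop[OF arm(1)[OF ji(1)]] by simp
        then show "x = dirac (L j ! Suc 0) \<or> (\<exists>d\<in>edges X1. d \<subseteq> set (drop (Suc 0) (L j)) \<and> x \<in> S' k d)"
          using d by blast
      qed (use arm(4)[OF ji(1)] in linarith)
      then have "S' k {0, L j ! 1} \<subseteq> D (Suc k)" using first(3)[OF ji(1)] by simp
      then have "S k {0, n - 1} \<subseteq> D k" using D_segment first(1,2)[OF ji(1)] by metis
      then have "D (k - 4) = realization (Y (k - 4))" using D_full[of "k - 4"] k by simp
      then show ?thesis using proper[of "k - 4"] k by simp
    qed
  qed
  have into: "D k \<subseteq> S k {0, n - 1}" if k: "m + 4 \<le> k" for k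
  proof
    fix y assume "y \<in> D k"
    then obtain x where x: "x \<in> D (Suc k)" "y = F k x" using D_map by blast
    then obtain j where j: "j \<in> {1..n}" "x \<in> S' k {0, L j ! 1}" using star[OF k] by blast
    then show "y \<in> S k {0, n - 1}"
      using F_bij[OF first(1)[OF j(1)], of k] x(2) unfolding first(2)[OF j(1)] bij_betw_def by blast
  qed
  show ?thesis
  proof
    fix x assume x: "x \<in> D (Suc k)"
    then obtain j where j: "j \<in> {1..n}" "x \<in> S' k {0, L j ! 1}" using star[of k x] k by fastforce
    \<comment> \<open>If \<open>j\<close> is not \<open>n - 1\<close>, then \<open>x\<close> is on
      the segments over both \<open>{0, j}\<close> and \<open>{0, n - 1}\<close>, which share only
      the branch point. The branch point lies on the first edge of arm \<open>n - 1\<close>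
      anyway.\<close>
    have x': "x \<in> S (Suc k) {0, n - 1}" using into[of "Suc k"] k x by auto
    have n1: "n - 1 \<in> {1..n}" using n by auto
    show "x \<in> S' k {0, L (n - 1) ! 1}"
    proof (cases "j = n - 1")
      case False
      obtain zs where zs: "L j = zs @ j # (if n - 1 \<le> j then [j + 2] else [])"
        using arm_split[OF j(1)] by blast
      have "zs \<noteq> []" using arm(2)[OF j(1)] j(1) zs by auto
      then have "{0, L j ! 1} \<in> path_edges (zs @ [j])"
        using arm(2)[OF j(1)] unfolding path_edges_iff_nth zs
        by (intro exI[of _ 0]) (cases zs; auto simp: nth_append)
      then have "x \<in> S (Suc k) {0, j}" using segment_refine[OF j(1) zs] j(2) by blast
      moreover have "{0, j} \<noteq> {0, n - 1}" using False by (auto simp: doubleton_eq_iff)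
      moreover have "{0, j} \<in> edges (X0 n)" "{0, n - 1} \<in> edges (X0 n)" using edges_X0 j n1 by auto
      ultimately obtain v where "v \<in> {0, j}" "v \<in> {0, n - 1}" "x = dirac v"
        using segment_Int[OF p _ _ _ _ x'] by metis
      then have "x = dirac 0" using False j(1) by auto
      then show ?thesis using segment_dirac[OF q first(1)[OF n1], of 0] by simp
    qed (use j in simp)
  qed
qed

section \<open>Projections that miss the branch point\<close>

text \<open>The vertices below \<open>n\<close> include the images of all vertices of
  \<open>X1\<close> at which \<open>\<phi>\<close> folds. If such vertices recurred, every level
  would contain \<open>n\<close> or \<open>n + 2\<close>, and some projection would cross
  \<open>0\<close>.\<close>

lemma D_avoids_branch_vertices:
  assumes z: "dirac 0 \<notin> D m"
  shows "\<exists>M. \<forall>k\<ge>M. \<forall>j<n. dirac j \<notin> D k"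
proof (rule ccontr)
  assume *: "\<nexists>M. \<forall>k\<ge>M. \<forall>j<n. dirac j \<notin> D k"
  have z': "dirac 0 \<notin> D k" if "m \<le> k" for k
    using that
  proof (induction rule: dec_induct)
    case (step i)
    then show ?case using D_dirac[of 0 i] phi_ends(8,9) by auto
  qed (rule z)
  \<comment> \<open>\<open>n\<close> and \<open>n + 2\<close> are fixed by \<open>\<phi>\<close>, so
    \<open>P\<close> passes from any level to all lower ones.\<close>
  define P where "P k \<longleftrightarrow> dirac n \<in> D k \<or> dirac (n + 2) \<in> D k" for k
  have Vn: "n \<in> verts X1" "n + 1 \<in> verts X1" "n + 2 \<in> verts X1" using phi_ends(7) n by auto
  have P1: "P k" if "P (Suc k)" for k
    using that D_dirac[OF Vn(1), of k] D_dirac[OF Vn(3), of k] phi_ends(4,6) by (auto simp: P_def)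
  have P2: "P k" if "dirac (n + 1) \<in> D (Suc k)" for k
    using D_dirac[OF Vn(2) that] phi_ends(5) by (simp add: P_def)
  \<comment> \<open>Two levels are needed only for \<open>n - 2\<close>, which goes to
    \<open>n + 1\<close> and then to \<open>n + 2\<close>.\<close>
  have P3: "P k" if j: "dirac j \<in> D (Suc (Suc k))" "1 \<le> j" "j < n" for j k
  proof -
    have jX: "j \<in> verts X1" using phi_ends(7) j by simp
    consider "j < n - 2" | "j = n - 2" | "j = n - 1" using j by linarith
    then have "\<phi> j = n \<or> \<phi> j = n + 1 \<or> \<phi> j = n + 2" using phi_ends(1,2,3) j by cases simp_all
    then show ?thesis using D_dirac[OF jX j(1)] P1[of k] P2[of k] by (auto simp: P_def)
  qed
  have P4: "P k \<Longrightarrow> i \<le> k \<Longrightarrow> P i" for i k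
    by (induction k) (use P1 le_Suc_eq in auto)
  have P: "P i" for i
  proof -
    \<comment> \<open>The level is at least \<open>m\<close>, which excludes \<open>j = 0\<close>,
      and at least two above \<open>i\<close>, as \<open>P3\<close> requires.\<close>
    obtain k j where k: "i + 2 + m \<le> k" "j < n" "dirac j \<in> D k" using * by blast
    then have "1 \<le> j" using z'[of k] by (cases j) auto
    moreover have "k = Suc (Suc (k - 2))" "i \<le> k - 2" using k(1) by auto
    ultimately show ?thesis using P3[of j "k - 2"] P4[of "k - 2" i] k by auto
  qed
  obtain k j where k: "m \<le> k" "j < n" "dirac j \<in> D k" using * by blast
  then have j: "1 \<le> j" using z'[of k] by (cases j) auto
  have n': "n \<in> {1..n}" "arm0 n n = [0, n, n + 2]" using n by (auto simp: arm0_def)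
  have e: "{0, j} \<in> edges (X0 n)" "{n, n + 2} \<in> edges (X0 n)" "{0, n} \<in> edges (X0 n)"
    using j k n by (auto simp: X0_def)
  obtain y where y: "y \<in> D k" "y = dirac n \<or> y = dirac (n + 2)" using P[of k] by (auto simp: P_def)
  \<comment> \<open>The vertex \<open>j\<close> and the point \<open>y\<close> are on different
    sides of the edge \<open>{0, n}\<close>, so the projection contains this edge and with it
    \<open>0\<close>.\<close>
  have "realization (p k {arm0 n n ! 0, arm0 n n ! Suc 0}) \<subseteq> D k"
  proof (rule od_crossing[OF p od_arms_X0[OF n] D_conn D_sub n'(1) _ k(3) _ y(1)])
    show "dirac j = dirac (arm0 n n ! 0) \<or>
      (\<exists>d\<in>edges (X0 n). d \<inter> set (drop (Suc 0) (arm0 n n)) = {} \<and> dirac j \<in> S k d)"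
      using e(1) segment_dirac[OF p e(1), of j] j k(2) n by (intro disjI2 bexI[of _ "{0, j}"]) (auto simp: n'(2))
    have "dirac (n + 2) \<in> S k {n, n + 2}" by (rule segment_dirac[OF p e(2)]) simp
    moreover have "{n, n + 2} \<subseteq> set (drop (Suc 0) (arm0 n n))" by (simp add: n'(2))
    ultimately show "y = dirac (arm0 n n ! Suc 0) \<or>
      (\<exists>d\<in>edges (X0 n). d \<subseteq> set (drop (Suc 0) (arm0 n n)) \<and> y \<in> S k d)"
      using y(2) e(2) by (metis n'(2) nth_Cons_0 nth_Cons_Suc)
  qed (simp add: n'(2))
  then have "S k {0, n} \<subseteq> D k" by (simp add: n'(2))
  then show False using segment_dirac[OF p e(3), of 0 k] z'[OF k(1)] by blast
qed

text \<open>\<open>D (Suc k)\<close> avoids every vertex of \<open>X1\<close> with image below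
  \<open>n\<close>. It is thus trapped either in a single edge or in the last two edges of an arm,
  and the bonding map is injective on each of these.\<close>

lemma D_between_branch_vertices:
  assumes avoid: "\<And>j. j < n \<Longrightarrow> dirac j \<notin> D k"
  shows "inj_on (F k) (D (Suc k)) \<and> (\<exists>j\<in>{1..n}. D (Suc k) \<subseteq> (\<Union>d\<in>path_edges (L j). S' k d))"
proof -
  have av: "dirac v \<notin> D (Suc k)" if "v \<in> verts X1" "\<phi> v < n" for v
    using D_dirac[OF that(1)] avoid[OF that(2)] by blast
  obtain x where x: "x \<in> D (Suc k)" using D_ne by blast
  then obtain d where d: "d \<in> edges X1" "x \<in> S' k d" using segment_cover[OF q] D_sub by blast
  then obtain j i where ji: "j \<in> {1..n}" "Suc i < length (L j)" "d = {L j ! i, L j ! Suc i}"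
    using od_edge_iff[OF q od] by blast
  obtain u a b where w: "phi_word n j = u @ [0, a, b]" "\<forall>v\<in>set u. v < n"
    "b \<noteq> 0" "{0, a} \<in> edges (X0 n)" "{a, b} \<in> edges (X0 n)"
    by (rule phi_word_split[OF n ji(1)])
  let ?m = "length u"
  have len: "length (L j) = ?m + 3" using arm(3)[OF ji(1)] w(1) by simp
  have Ev: "L j ! l \<in> verts X1" if "l < length (L j)" for l using arm(5)[OF ji(1)] that by auto
  \<comment> \<open>The positions up to \<open>length u\<close> carry the entries of
    \<open>u\<close> and the \<open>0\<close> after it, all below \<open>n\<close>.\<close>
  have low: "dirac (L j ! l) \<notin> D (Suc k)" if "l \<le> ?m" for l
  proof -
    have "phi_word n j ! l < n" using that w(1,2) n by (auto simp: nth_append nth_Cons')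
    then show ?thesis using av[OF Ev] arm(6)[OF ji(1), of l] that len by simp
  qed
  have pe: "{L j ! l, L j ! Suc l} \<in> path_edges (L j)" "{L j ! l, L j ! Suc l} \<in> edges X1"
    if "Suc l < length (L j)" for l
    using that ji(1) arm_edge by (auto simp: path_edges_iff_nth)
  show ?thesis
  proof (cases "Suc i \<le> ?m")
    case True
    have D: "D (Suc k) \<subseteq> (\<Union>d\<in>{d}. S' k d)"
    proof (rule connected_in_segments[OF q D_conn D_sub _ x _ d(2)])
      fix d1 d2 v assume "d1 \<in> {d}" "v \<in> d1"
      then show "dirac v \<notin> D (Suc k)" using low True ji(3) by auto
    qed (use d in auto)
    then have "inj_on (F k) (D (Suc k))"
      using F_bij[OF d(1), of k] by (auto simp: bij_betw_def intro: inj_on_subset)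
    then show ?thesis using D pe(1)[OF ji(2)] ji by blast
  next
    case False
    define d1 d2 where "d1 = {L j ! ?m, L j ! Suc ?m}" and "d2 = {L j ! Suc ?m, L j ! Suc (Suc ?m)}"
    have dE: "d1 \<in> edges X1" "d2 \<in> edges X1" "d1 \<in> path_edges (L j)" "d2 \<in> path_edges (L j)"
      using pe len by (auto simp: d1_def d2_def)
    have di: "{L j ! l, L j ! Suc l} \<in> {d1, d2}" if "?m \<le> l" "Suc l < length (L j)" for l
    proof -
      have "l = ?m \<or> l = Suc ?m" using that len by linarith
      then show ?thesis by (auto simp: d1_def d2_def)
    qed
    have D: "D (Suc k) \<subseteq> (\<Union>d\<in>{d1, d2}. S' k d)"
    proof (rule connected_in_segments[OF q D_conn D_sub _ x _ d(2)])
      show "d \<in> {d1, d2}" using di[of i] ji False by simp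
      \<comment> \<open>The only exit from the last two edges is the inner end at position
        \<open>length u\<close>, which is avoided; the two outer vertices lie on no edge except
        \<open>d1\<close> and \<open>d2\<close>.\<close>
      fix d' d'' v assume d': "d' \<in> {d1, d2}" "d'' \<in> edges X1 - {d1, d2}" "v \<in> d'" "v \<in> d''"
      show "dirac v \<notin> D (Suc k)"
      proof (cases "v = L j ! ?m")
        case False
        then have v: "v \<in> set (drop (Suc ?m) (L j))"
          using d'(1,3) nth_in_set_drop[OF arm(1)[OF ji(1)]] len by (auto simp: d1_def d2_def)
        obtain j' i' where ji': "j' \<in> {1..n}" "Suc i' < length (L j')" "d'' = {L j' ! i', L j' ! Suc i'}"
          using d'(2) od_edge_iff[OF q od] by blast
        have "0 \<notin> set (drop (Suc ?m) (L j))"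
          using nth_in_set_drop[OF arm(1)[OF ji(1)], of 0 "Suc ?m"] arm(2)[OF ji(1)] len by simp
        then have "v \<noteq> 0" using v by metis
        moreover have "v \<in> set (L j')" "v \<in> set (L j)" using ji' d'(4) v by (auto dest: in_set_dropD)
        ultimately have jj: "j' = j" using od_share[OF q od ji'(1) ji(1)] by blast
        have "Suc ?m \<le> Suc i'"
          using v d'(4) ji' nth_in_set_drop[OF arm(1)[OF ji(1)]] unfolding jj by fastforce
        then show ?thesis using di[of i'] ji' d'(2) unfolding jj by simp
      qed (use low in simp)
    qed (use dE in auto)
    have vals: "\<phi> (L j ! ?m) = 0" "\<phi> (L j ! Suc ?m) = a" "\<phi> (L j ! Suc (Suc ?m)) = b"
      using arm(6)[OF ji(1), of ?m] arm(6)[OF ji(1), of "Suc ?m"] arm(6)[OF ji(1), of "Suc (Suc ?m)"] len w(1)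
      by (simp_all add: nth_append)
    have b1: "bij_betw (F k) (S' k d1) (S k {0, a})" using F_bij[OF dE(1), of k] vals by (simp add: d1_def)
    have b2: "bij_betw (F k) (S' k d2) (S k {a, b})" using F_bij[OF dE(2), of k] vals by (simp add: d2_def)
    have a: "{0, a} \<noteq> {a, b}" using w(3) by (auto simp: doubleton_eq_iff)
    \<comment> \<open>The images of the two edges share only the vertex \<open>a\<close>, whose
      preimage in both is the vertex between \<open>d1\<close> and \<open>d2\<close>.\<close>
    have cross: "x = y" if xy: "x \<in> S' k d1" "y \<in> S' k d2" "F k x = F k y" for x y
    proof -
      have "F k x \<in> S k {0, a}" "F k x \<in> S k {a, b}"
        using bij_betwE[OF b1] bij_betwE[OF b2] xy by auto
      then obtain v where v: "v \<in> {0, a}" "v \<in> {a, b}" "F k x = dirac v"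
        using segment_Int[OF p w(4,5) a] by metis
      have "a \<noteq> 0" using subdivision_edge[OF p w(4)] by (cases "a = 0") simp_all
      then have "v = a" using v w(3) by auto
      moreover have "F k (dirac (L j ! Suc ?m)) = dirac a" using F_dirac[OF Ev] vals(2) len by simp
      moreover have "dirac (L j ! Suc ?m) \<in> S' k d1" "dirac (L j ! Suc ?m) \<in> S' k d2"
        using segment_dirac[OF q dE(1)] segment_dirac[OF q dE(2)] by (auto simp: d1_def d2_def)
      ultimately show "x = y" using xy v(3) b1 b2 unfolding bij_betw_def by (metis inj_onD)
    qed
    have "inj_on (F k) (D (Suc k))"
    proof (rule inj_onI)
      fix x y assume xy: "x \<in> D (Suc k)" "y \<in> D (Suc k)" "F k x = F k y"
      consider "x \<in> S' k d1" "y \<in> S' k d1" | "x \<in> S' k d2" "y \<in> S' k d2"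
        | "x \<in> S' k d1" "y \<in> S' k d2" | "x \<in> S' k d2" "y \<in> S' k d1"
        using D xy by blast
      then show "x = y"
        using xy(3) b1 b2 cross[of x y] cross[of y x] by cases (auto simp: bij_betw_def dest: inj_onD)
    qed
    then show ?thesis using D dE ji(1) by blast
  qed
qed

lemma D_eventually_in_arm:
  assumes proper: "\<And>k. m \<le> k \<Longrightarrow> D k \<noteq> realization (Y k)"
  shows "\<exists>K. \<forall>k\<ge>K. inj_on (F k) (D (Suc k)) \<and>
    (\<exists>j\<in>{1..n}. D (Suc k) \<subseteq> (\<Union>d\<in>path_edges (L j). S' k d))"
proof (cases "\<forall>k. dirac 0 \<in> D k")
  case True
  have n1: "n - 1 \<in> {1..n}" using n by auto
  have d: "{0, L (n - 1) ! 1} \<in> path_edges (L (n - 1))"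
    using arm(2,4)[OF n1] by (auto simp: path_edges_iff_nth intro!: exI[of _ 0])
  then have "{0, L (n - 1) ! 1} \<in> edges X1" using od n1 by (auto simp: od_arms_def)
  then have "inj_on (F k) (S' k {0, L (n - 1) ! 1})" for k using F_bij by (auto simp: bij_betw_def)
  moreover have "D (Suc k) \<subseteq> S' k {0, L (n - 1) ! 1}" if "m + 5 \<le> k" for k
    using D_star[of m k] True proper that by blast
  ultimately have "inj_on (F k) (D (Suc k)) \<and> D (Suc k) \<subseteq> (\<Union>d\<in>path_edges (L (n - 1)). S' k d)"
    if "m + 5 \<le> k" for k
    using that d by (meson UN_upper inj_on_subset subset_trans)
  then show ?thesis using n1 by meson
next
  case False
  then obtain M where "\<forall>k\<ge>M. \<forall>j<n. dirac j \<notin> D k" using D_avoids_branch_vertices by meson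
  then show ?thesis using D_between_branch_vertices by meson
qed

end

section \<open>The inverse limit\<close>

text \<open>Segments over edges of different arms meet only where these edges do, that is, at most
  in \<open>z\<close>.\<close>

lemma od_arms_subdivision:
  assumes p: "subdivision_arcs G G' p" and od: "od_arms G z J L"
    and A: "\<And>j. j \<in> J \<Longrightarrow> distinct (A j) \<and> 2 \<le> length (A j) \<and> hd (A j) = z"
    and pA: "\<And>j. j \<in> J \<Longrightarrow> subdivision_arcs (path_graph (L j)) (path_graph (A j)) p"
  shows "od_arms G' z J A"
proof -
  have E: "edges G = (\<Union>j\<in>J. path_edges (L j))" using od by (simp add: od_arms_def)
  have EA: "path_edges (A j) = (\<Union>e\<in>path_edges (L j). edges (p e))"
    and VA: "set (A j) = (\<Union>e\<in>path_edges (L j). verts (p e))" if "j \<in> J" for j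
    using subdivision_arcsD(6,7)[OF pA[OF that]] by simp_all
  have "set (A i) \<inter> set (A j) \<subseteq> {z}" if ij: "i \<in> J" "j \<in> J" "i \<noteq> j" for i j
  proof
    fix v assume "v \<in> set (A i) \<inter> set (A j)"
    then obtain d e where de: "d \<in> path_edges (L i)" "e \<in> path_edges (L j)" "v \<in> verts (p d)" "v \<in> verts (p e)"
      using VA[OF ij(1)] VA[OF ij(2)] by auto
    have z: "d \<inter> e \<subseteq> {z}"
      using path_edges_subset[OF de(1)] path_edges_subset[OF de(2)] od ij unfolding od_arms_def by blast
    have G: "d \<in> edges G" "e \<in> edges G" using de(1,2) ij E by auto
    have "card d = 2" using subdivision_arcsD(1)[OF p] G by (simp add: is_graph_def)
    then have "\<not> d \<subseteq> {z}" using card_mono[of "{z}" d] by auto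
    then have "d \<noteq> e" using z by auto
    then show "v \<in> {z}" using subdivision_arcsD(5)[OF p G] de(3,4) z by blast
  qed
  moreover have "edges G' = (\<Union>j\<in>J. path_edges (A j))"
    using subdivision_arcsD(7)[OF p] E EA by auto
  ultimately show ?thesis using A by (auto simp: od_arms_def)
qed

text \<open>Fixes one pair of arc families for each level. The tower starts at \<open>X 1\<close>
  because the matching condition describes \<open>\<psi> i\<close> only for
  \<open>i \<ge> 1\<close>.\<close>

lemma phi_sequence_tower:
  assumes n: "3 \<le> n" and X: "phi_sequence n X \<psi>"
  obtains p q L where "phi_tower n (X 1) (\<psi> 0) (\<lambda>k. X (Suc k)) (\<lambda>k. \<psi> (Suc k)) p q L"
proof -
  have X0: "X 0 = X0 n" and phi: "is_phi n (X 1) (\<psi> 0)"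
    and match: "\<And>k. matching_subdivision (X 1) (X 0) (\<psi> 0) (X (Suc k)) (X (Suc (Suc k))) (\<psi> (Suc k))"
    using X by (auto simp: phi_sequence_def)
  obtain p1 A where p1: "subdivision_arcs (X0 n) (X 1) p1"
    and A: "\<And>i. i \<in> {1..n} \<Longrightarrow> distinct (A i) \<and> hd (A i) = 0 \<and> suffix (tl (arm0 n i)) (A i) \<and>
           subdivision_arcs (path_graph (arm0 n i)) (path_graph (A i)) p1 \<and>
           map (\<psi> 0) (A i) = phi_word n i"
    using phi unfolding is_phi_def by blast
  have "\<exists>p0 p1. subdivision_arcs (X 0) (X (Suc k)) p0 \<and> subdivision_arcs (X 1) (X (Suc (Suc k))) p1 \<and>
        (\<forall>e\<in>edges (X 1). graph_iso (p1 e) (p0 (\<psi> 0 ` e)) (\<psi> (Suc k)))" for k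
    using match[of k] unfolding matching_subdivision_def by blast
  then obtain p q where pq: "\<And>k. subdivision_arcs (X 0) (X (Suc k)) (p k)"
    "\<And>k. subdivision_arcs (X 1) (X (Suc (Suc k))) (q k)"
    "\<And>k e. e \<in> edges (X 1) \<Longrightarrow> graph_iso (q k e) (p k (\<psi> 0 ` e)) (\<psi> (Suc k))"
    by metis
  have "od_arms (X 1) 0 {1..n} A"
  proof (rule od_arms_subdivision[OF p1 od_arms_X0[OF n]])
    fix j assume j: "j \<in> {1..n}"
    have "length (A j) = length (phi_word n j)" using A[OF j] by (metis length_map)
    then show "distinct (A j) \<and> 2 \<le> length (A j) \<and> hd (A j) = 0"
      using A[OF j] phi_word_nth(3)[OF n, of j] by simp
  qed (use A in blast)
  then have "phi_tower n (X 1) (\<psi> 0) (\<lambda>k. X (Suc k)) (\<lambda>k. \<psi> (Suc k)) p q A"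
    using n pq A match X0 by unfold_locales (auto simp: matching_subdivision_def)
  then show ?thesis by (rule that)
qed

section \<open>From the projections back to the subcontinuum\<close>

text \<open>A point of the limit is matched by points of \<open>C\<close> on longer and longer
  initial segments of coordinates, since agreement at one coordinate passes to all lower ones. These
  points converge to it in the product topology.\<close>

lemma closed_subset_inverse_limit_eq:
  fixes X :: "nat \<Rightarrow> 'v::countable graph"
  assumes C: "closed C" "C \<subseteq> inverse_limit X \<psi>"
    and full: "\<And>m. \<exists>k\<ge>m. realization (X k) \<subseteq> (\<lambda>x. x k) ` C"
  shows "C = inverse_limit X \<psi>"
proof
  show "inverse_limit X \<psi> \<subseteq> C"
  proof
    fix x assume x: "x \<in> inverse_limit X \<psi>"
    have "\<exists>y\<in>C. \<forall>i\<le>m. y i = x i" for m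
    proof -
      obtain k where k: "m \<le> k" "realization (X k) \<subseteq> (\<lambda>x. x k) ` C" using full by blast
      have "x k \<in> realization (X k)" using x by (simp add: inverse_limit_def)
      then obtain y where y: "y \<in> C" "y k = x k" using k(2) by force
      then have y': "y \<in> inverse_limit X \<psi>" using C by blast
      have "y i = x i" if "i \<le> k" for i
        using that
      proof (induction rule: inc_induct)
        case (step j)
        then show ?case using x y' unfolding inverse_limit_def by (metis (mono_tags, lifting) mem_Collect_eq)
      qed (rule y(2))
      then show ?thesis using y(1) k(1) by (meson order_trans)
    qed
    then obtain y where y: "\<And>m. y m \<in> C" "\<And>m i. i \<le> m \<Longrightarrow> y m i = x i" by metis
    have "(\<lambda>m. y m i) \<longlonglongrightarrow> x i" for i
      using y(2) by (intro tendsto_eventually eventually_sequentiallyI[of i])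
    then have "y \<longlonglongrightarrow> x" 
      using limitin_componentwise[of "\<lambda>_. euclidean" UNIV y x sequentially]
      by (simp add: euclidean_product_topology)
    then show "x \<in> C" using closed_sequentially[OF C(1)] y(1) by blast
  qed
qed (rule C(2))

theorem mainTheorem4:
  fixes n :: nat
    and X :: "nat \<Rightarrow> nat graph"
    and \<psi> :: "nat \<Rightarrow> nat \<Rightarrow> nat"
    and C :: "(nat \<Rightarrow> nat \<Rightarrow> real) set"
  assumes "n \<ge> 3"
    and "phi_sequence n X \<psi>"
    and "C \<subseteq> inverse_limit X \<psi>"
    and "C \<noteq> inverse_limit X \<psi>"
    and "continuum C"
    and "nondegenerate C"
  shows "C homeomorphic {0..1::real}"
proof -
  have C: "compact C" "connected C" "C \<noteq> {}" using assms(5) by (auto simp: continuum_def)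
  have lim: "x i \<in> realization (X i)" "realize_map (X (Suc i)) (\<psi> i) (x (Suc i)) = x i"
    if "x \<in> C" for x i using that assms(3) by (auto simp: inverse_limit_def)
  obtain p q L where tower: "phi_tower n (X 1) (\<psi> 0) (\<lambda>k. X (Suc k)) (\<lambda>k. \<psi> (Suc k)) p q L"
    by (rule phi_sequence_tower[OF assms(1,2)])
  \<comment> \<open>Level \<open>k\<close> of the tower is coordinate \<open>Suc k\<close>.\<close>
  define D where "D k = (\<lambda>x. x (Suc k)) ` C" for k
  have proj: "continuous_on C (\<lambda>x. x k)" for k
    by (rule continuous_on_subset[OF continuous_on_product_coordinates]) simp
  interpret phi_tower_continuum n "X 1" "\<psi> 0" "\<lambda>k. X (Suc k)" "\<lambda>k. \<psi> (Suc k)" p q L D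
  proof (intro phi_tower_continuum.intro tower phi_tower_continuum_axioms.intro)
    show "D k \<subseteq> realization (X (Suc k))" for k using lim(1) by (auto simp: D_def)
    show "connected (D k)" for k unfolding D_def by (rule connected_continuous_image[OF proj C(2)])
    show "D k \<noteq> {}" for k using C(3) by (simp add: D_def)
    show "realize_map (X (Suc (Suc k))) (\<psi> (Suc k)) ` D (Suc k) = D k" for k
      unfolding D_def image_image by (rule image_cong) (simp_all add: lim(2))
  qed
  have "\<exists>m. \<forall>k\<ge>m. \<not> realization (X k) \<subseteq> (\<lambda>x. x k) ` C"
    using closed_subset_inverse_limit_eq[OF compact_imp_closed[OF C(1)] assms(3)] assms(4) by metis
  then obtain m where m: "\<And>k. m \<le> k \<Longrightarrow> \<not> realization (X k) \<subseteq> (\<lambda>x. x k) ` C" by blast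
  have "D k \<noteq> realization (X (Suc k))" if "m \<le> k" for k
    using m[of "Suc k"] that by (auto simp: D_def)
  from D_eventually_in_arm[OF this] obtain K where
    K': "\<forall>k\<ge>K. inj_on (F k) (D (Suc k)) \<and>
      (\<exists>j\<in>{1..n}. D (Suc k) \<subseteq> (\<Union>d\<in>path_edges (L j). S' k d))" by (rule exE)
  then have K: "inj_on (F k) (D (Suc k))" if "K \<le> k" for k using that by simp
  from K' obtain j where j: "j \<in> {1..n}" "D (Suc K) \<subseteq> (\<Union>d\<in>path_edges (L j). S' K d)" by auto
  obtain c :: "(nat \<Rightarrow> real) \<Rightarrow> real" where c: "continuous_on (\<Union>d\<in>path_edges (L j). S' K d) c"
    "inj_on c (\<Union>d\<in>path_edges (L j). S' K d)"
    by (rule od_arm_embedding[OF q od j(1)])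
  \<comment> \<open>\<open>D (Suc K)\<close> consists of coordinates number
    \<open>Suc (Suc K)\<close> and lies in one arm, so the arm coordinate \<open>c\<close> is
    defined on it.\<close>
  define h where "h x = c (x (Suc (Suc K)))" for x
  have cont: "continuous_on C h"
    unfolding h_def
    by (rule continuous_on_compose2[OF c(1) proj]) (use j(2) in \<open>simp add: D_def\<close>)
  have inj: "inj_on h C"
  proof (rule inj_onI)
    fix x y assume xy: "x \<in> C" "y \<in> C" "h x = h y"
    then have "x (Suc (Suc K)) \<in> (\<Union>d\<in>path_edges (L j). S' K d)"
      "y (Suc (Suc K)) \<in> (\<Union>d\<in>path_edges (L j). S' K d)" using j(2) by (auto simp: D_def)
    then have eq: "x (Suc (Suc K)) = y (Suc (Suc K))" using xy(3) c(2) unfolding h_def by (meson inj_onD)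
    show "x = y"
    proof
      \<comment> \<open>Lower coordinates follow by applying bonding maps, higher ones by the
        injectivity of the bonding maps on the projections from \<open>K\<close> on.\<close>
      fix i show "x i = y i"
      proof (cases "i \<le> Suc (Suc K)")
        case True
        then show ?thesis
        proof (induction rule: inc_induct)
          case (step l)
          then show ?case using lim(2)[OF xy(1), of l] lim(2)[OF xy(2), of l] by simp
        qed (rule eq)
      next
        case False
        then have "Suc (Suc K) \<le> i" by simp
        then show ?thesis
        proof (induction rule: dec_induct)
          case (step l)
          then obtain k where k: "l = Suc k" "K \<le> k" by (cases l) auto
          have "F k (x (Suc l)) = F k (y (Suc l))"
            using lim(2)[OF xy(1), of l] lim(2)[OF xy(2), of l] step k by simp
          moreover have "x (Suc l) \<in> D (Suc k)" "y (Suc l) \<in> D (Suc k)"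
            using xy k by (auto simp: D_def)
          ultimately show ?case using K[OF k(2)] by (meson inj_onD)
        qed (rule eq)
      qed
    qed
  qed
  \<comment> \<open>A compact connected subset of the line is a closed interval; by injectivity two
    points of \<open>C\<close> keep it from being a single point.\<close>
  have "connected (h ` C)" "compact (h ` C)"
    using C cont by (auto intro: connected_continuous_image compact_continuous_image)
  then have "\<exists>a b. h ` C = {a..b}" by (simp flip: connected_compact_interval_1)
  then obtain a b where ab: "h ` C = {a..b}" by (elim exE)
  obtain x y where "x \<in> C" "y \<in> C" "x \<noteq> y" using assms(6) by (auto simp: nondegenerate_def)
  then have "h x \<in> {a..b}" "h y \<in> {a..b}" "h x \<noteq> h y"
    using imageI[of _ C h] ab inj by (auto dest: inj_onD)
  then have "a < b" by auto
  have "C homeomorphic {a..b}" by (rule homeomorphic_compact[OF C(1) cont ab inj])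
  also have "{a..b} homeomorphic {0..1::real}"
    using \<open>a < b\<close> by (intro homeomorphic_closed_intervals_real) simp_all
  finally show ?thesis .
qed

end
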